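(* Let $X_0\subset\operatorname{dom}F$, $Y_0\subset\operatorname{dom}G$ be bounded and such that $X_0\times Y_0$ contains a saddle-point of $L$. Let $\sigma,\tau>0$ and let $M$ be a feasible preconditioner for $T=\mathrm{id}+\sigma\tau K^*K$. Let $(\bar x^0,\bar y^0,d^0)\in X\times Y\times X$ and let $\{(x^k,y^k)\}_{k\ge1}$ be generated by the preconditioned Douglas--Rachford iteration (pDR). Then $(x^k,y^k)$ converges weakly to some $(x^*,y^* )$ which is a saddle-point of $L$. Additionally, the ergodic sequence given by $$x^k_{\mathrm{erg}}=\frac1k\sum_{k'=1}^kx^{k'},\qquad y^k_{\mathrm{erg}}=\frac1k\sum_{k'=1}^ky^{k'}$$ converges weakly to $(x^*,y^* )$, and the restricted primal-dual gap obeys, for all $k\ge1$, $$\mathfrak G_{X_0\times Y_0}(x^k_{\mathrm{erg}},y^k_{\mathrm{erg}})\le\frac1k\sup_{(x,y)\in X_0\times Y_0}\Bigl[\frac{\|\bar x^0-x+\sigma K^*y\|^2}{2\sigma}+\frac{\|d^0-x\|_{M-T}^2}{2\sigma}+\frac{\|\bar y^0-y-\tau Kx\|^2}{2\tau}\Bigr],$$ where $\|x\|_{M-T}^2=\langle(M-T)x,x\rangle$.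
   Context: $X,Y$ are real Hilbert spaces, $K:X\to Y$ is linear and continuous with adjoint $K^*$, and $F:X\to(-\infty,\infty]$, $G:Y\to(-\infty,\infty]$ are proper, convex and lower semi-continuous. $L(x,y)=\langle Kx,y\rangle+F(x)-G(y)$ on $\operatorname{dom}F\times\operatorname{dom}G$; a saddle-point is $(x^*,y^* )\in\operatorname{dom}F\times\operatorname{dom}G$ with $L(x^*,y)\le L(x^*,y^* )\le L(x,y^* )$ for all $(x,y)\in\operatorname{dom}F\times\operatorname{dom}G$. Restricted primal-dual gap: $\mathfrak G_{X_0\times Y_0}(x,y)=\sup_{(x',y')\in X_0\times Y_0}\,[L(x,y')-L(x',y)]$. Feasible preconditioner: for linear, self-adjoint, continuous, positive semi-definite $M,T:X\to X$, $M$ is called a feasible preconditioner for $T$ if $M$ is boundedly invertible and $M-T$ is positive semi-definite. Iteration (pDR), for $k\ge0$: $x^{k+1}=(\mathrm{id}+\sigma\partial F)^{-1}(\bar x^k)$, $y^{k+1}=(\mathrm{id}+\tau\partial G)^{-1}(\bar y^k)$, $b^{k+1}=(2x^{k+1}-\bar x^k)-\sigma K^*(2y^{k+1}-\bar y^k)$, $d^{k+1}=d^k+M^{-1}(b^{k+1}-Td^k)$, $\bar x^{k+1}=\bar x^k-x^{k+1}+d^{k+1}$, $\bar y^{k+1}=y^{k+1}+\tau Kd^{k+1}$. Here $(\mathrm{id}+\sigma\partial F)^{-1}$ denotes the resolvent (proximal map) of the subdifferential. *)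

theory Defs
  imports "HOL-Analysis.Analysis"
begin

text \<open>
  Real Hilbert spaces are types of sort \<open>{real_inner, complete_space}\<close>. Functionals with values
  in \<open>(-\<infinity>, \<infinity>]\<close> are \<open>ereal\<close>-valued functions that avoid \<open>-\<infinity>\<close>; this is part of properness.
\<close>

definition eff_dom :: "('a \<Rightarrow> ereal) \<Rightarrow> 'a set" where
  "eff_dom F = {x. F x < \<infinity>}"

definition proper :: "('a \<Rightarrow> ereal) \<Rightarrow> bool" where
  "proper F \<longleftrightarrow> (\<forall>x. F x \<noteq> -\<infinity>) \<and> eff_dom F \<noteq> {}"

definition convex_fun :: "('a::real_vector \<Rightarrow> ereal) \<Rightarrow> bool" where
  "convex_fun F \<longleftrightarrow> (\<forall>x y. \<forall>u\<ge>0. \<forall>v\<ge>0. u + v = 1 \<longrightarrow>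
     F (u *\<^sub>R x + v *\<^sub>R y) \<le> ereal u * F x + ereal v * F y)"

definition lower_semicontinuous :: "('a::topological_space \<Rightarrow> ereal) \<Rightarrow> bool" where
  "lower_semicontinuous F \<longleftrightarrow> (\<forall>x. F x \<le> Liminf (at x) F)"

text \<open>
  For a proper \<open>F\<close> the defining inequality fails for every \<open>g\<close> when \<open>F x = \<infinity>\<close>,
  so the subdifferential is empty outside \<open>eff_dom F\<close>.
\<close>

definition subdifferential :: "('a::real_inner \<Rightarrow> ereal) \<Rightarrow> 'a \<Rightarrow> 'a set" where
  "subdifferential F x = {g. \<forall>z. F x + ereal (g \<bullet> (z - x)) \<le> F z}"

text \<open>
  The resolvent \<open>(id + s A)\<^sup>-\<^sup>1\<close> of a set-valued operator \<open>A\<close>, as a single-valued map. For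
  \<open>A = subdifferential F\<close> with \<open>F\<close> proper, convex and lower semicontinuous and \<open>s > 0\<close>,
  the point described exists and is unique (it is the proximal point of \<open>z\<close>).
\<close>

definition resolvent :: "real \<Rightarrow> ('a::real_vector \<Rightarrow> 'a set) \<Rightarrow> 'a \<Rightarrow> 'a" where
  "resolvent s A z = (THE x. \<exists>g\<in>A x. x + s *\<^sub>R g = z)"

text \<open>
  The Lagrangian is only meaningful on \<open>eff_dom F \<times> eff_dom G\<close>, where its value is finite;
  off that set the value given by \<open>ereal\<close> arithmetic plays no role.
\<close>

definition lagrangian ::
  "('a::real_inner \<Rightarrow> 'b::real_inner) \<Rightarrow> ('a \<Rightarrow> ereal) \<Rightarrow> ('b \<Rightarrow> ereal) \<Rightarrow> 'a \<Rightarrow> 'b \<Rightarrow> ereal" where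
  "lagrangian K F G x y = ereal (K x \<bullet> y) + F x - G y"

definition saddle_point ::
  "('a::real_inner \<Rightarrow> 'b::real_inner) \<Rightarrow> ('a \<Rightarrow> ereal) \<Rightarrow> ('b \<Rightarrow> ereal) \<Rightarrow> 'a \<Rightarrow> 'b \<Rightarrow> bool" where
  "saddle_point K F G xs ys \<longleftrightarrow> xs \<in> eff_dom F \<and> ys \<in> eff_dom G \<and>
     (\<forall>x\<in>eff_dom F. \<forall>y\<in>eff_dom G.
        lagrangian K F G xs y \<le> lagrangian K F G xs ys \<and>
        lagrangian K F G xs ys \<le> lagrangian K F G x ys)"

definition restricted_gap ::
  "('a::real_inner \<Rightarrow> 'b::real_inner) \<Rightarrow> ('a \<Rightarrow> ereal) \<Rightarrow> ('b \<Rightarrow> ereal) \<Rightarrow>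
   'a set \<Rightarrow> 'b set \<Rightarrow> 'a \<Rightarrow> 'b \<Rightarrow> ereal" where
  "restricted_gap K F G X0 Y0 x y =
     (SUP (x', y') \<in> X0 \<times> Y0. lagrangian K F G x y' - lagrangian K F G x' y)"

definition self_adjoint :: "('a::real_inner \<Rightarrow> 'a) \<Rightarrow> bool" where
  "self_adjoint A \<longleftrightarrow> (\<forall>x y. A x \<bullet> y = x \<bullet> A y)"

definition pos_semidef :: "('a::real_inner \<Rightarrow> 'a) \<Rightarrow> bool" where
  "pos_semidef A \<longleftrightarrow> (\<forall>x. 0 \<le> A x \<bullet> x)"

definition boundedly_invertible :: "('a::real_normed_vector \<Rightarrow> 'a) \<Rightarrow> bool" where
  "boundedly_invertible A \<longleftrightarrow> bij A \<and> bounded_linear (inv A)"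

definition feasible_preconditioner :: "('a::real_inner \<Rightarrow> 'a) \<Rightarrow> ('a \<Rightarrow> 'a) \<Rightarrow> bool" where
  "feasible_preconditioner M T \<longleftrightarrow>
     bounded_linear M \<and> self_adjoint M \<and> pos_semidef M \<and>
     bounded_linear T \<and> self_adjoint T \<and> pos_semidef T \<and>
     boundedly_invertible M \<and> pos_semidef (\<lambda>x. M x - T x)"

text \<open>\<open>\<parallel>x\<parallel>\<^sup>2\<close> with respect to the (semi-)inner product induced by a positive semidefinite \<open>A\<close>.\<close>

definition weighted_norm_sq :: "('a::real_inner \<Rightarrow> 'a) \<Rightarrow> 'a \<Rightarrow> real" where
  "weighted_norm_sq A x = A x \<bullet> x"

definition weakly_convergent_to :: "(nat \<Rightarrow> 'a::real_normed_vector) \<Rightarrow> 'a \<Rightarrow> bool" where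
  "weakly_convergent_to u l \<longleftrightarrow>
     (\<forall>f :: 'a \<Rightarrow> real. bounded_linear f \<longrightarrow> (\<lambda>n. f (u n)) \<longlonglongrightarrow> f l)"

text \<open>
  Preconditioned Douglas--Rachford iteration. The values \<open>x 0\<close>, \<open>y 0\<close>, \<open>b 0\<close> are not constrained
  and not used; the initial data are \<open>xbar 0\<close>, \<open>ybar 0\<close>, \<open>d 0\<close>.
\<close>

definition pDR_iteration ::
  "('a::real_inner \<Rightarrow> 'b::real_inner) \<Rightarrow> ('a \<Rightarrow> ereal) \<Rightarrow> ('b \<Rightarrow> ereal) \<Rightarrow> real \<Rightarrow> real \<Rightarrow>
   ('a \<Rightarrow> 'a) \<Rightarrow> ('a \<Rightarrow> 'a) \<Rightarrow>
   (nat \<Rightarrow> 'a) \<Rightarrow> (nat \<Rightarrow> 'b) \<Rightarrow> (nat \<Rightarrow> 'a) \<Rightarrow> (nat \<Rightarrow> 'a) \<Rightarrow> (nat \<Rightarrow> 'a) \<Rightarrow> (nat \<Rightarrow> 'b) \<Rightarrow> bool" where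
  "pDR_iteration K F G \<sigma> \<tau> M T x y b d xbar ybar \<longleftrightarrow> (\<forall>k.
     x (Suc k) = resolvent \<sigma> (subdifferential F) (xbar k) \<and>
     y (Suc k) = resolvent \<tau> (subdifferential G) (ybar k) \<and>
     b (Suc k) = (2 *\<^sub>R x (Suc k) - xbar k) - \<sigma> *\<^sub>R adjoint K (2 *\<^sub>R y (Suc k) - ybar k) \<and>
     d (Suc k) = d k + inv M (b (Suc k) - T (d k)) \<and>
     xbar (Suc k) = xbar k - x (Suc k) + d (Suc k) \<and>
     ybar (Suc k) = y (Suc k) + \<tau> *\<^sub>R K (d (Suc k)))"

text \<open>Averages over the indices \<open>1, \<dots>, k\<close>; only \<open>k \<ge> 1\<close> is meaningful.\<close>

definition ergodic :: "(nat \<Rightarrow> 'a::real_vector) \<Rightarrow> nat \<Rightarrow> 'a" where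
  "ergodic u k = (1 / real k) *\<^sub>R (\<Sum>i=1..k. u i)"

end

theory Submission
  imports Defs "HOL-Library.Diagonal_Subsequence"
begin

text \<open>
  The iteration is a proximal point method in disguise. Attach to a pair \<open>(u, v)\<close> the energy
  \<open>\<parallel>xbar - u + \<sigma> K\<^sup>* v\<parallel>\<^sup>2 / (2 \<sigma>) + \<parallel>d - u\<parallel>\<^sup>2 / (2 \<sigma>) + \<parallel>ybar - v - \<tau> K u\<parallel>\<^sup>2 / (2 \<tau>)\<close>,
  the middle norm being that of \<open>N = M - T\<close>. Expanding the squares, the decrease of the energy in one
  step equals the squared length of the step plus an inner product (\<open>energy_diff\<close>), and the update rules turn
  that inner product into precisely the terms that the subgradient inequalities of the two resolvents
  bound from below by the primal-dual gap (\<open>increment_bound_eq\<close>, \<open>gap_le_increment_bound\<close>). Summing over the steps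
  and using convexity of the gap yields the ergodic estimate (\<open>ergodic_gap_le\<close>).

  For convergence, take the energy of a saddle-point: it decreases, so the iterates are bounded and the steps
  tend to zero. Then the inner product above tends to zero for each \<open>(u, v)\<close>, so the gap of the iterates is
  asymptotically nonpositive, and weak lower semicontinuity makes every weak cluster point
  a saddle-point (\<open>weak_limit_saddle_point\<close>). That there is only one cluster point follows as in Opial's lemma: the
  difference of the energies of two saddle-points converges and is affine in the state, hence a linear functional of
  the iterates converges which distinguishes the two (\<open>separator_convergent\<close>,
  \<open>opial_separating_functionals\<close>). The seminorm of \<open>N\<close> may vanish, but the other two terms of the energy already make
  this functional definite (\<open>separator_diag_nonzero\<close>). Averages inherit the weak limit.

  The functional analysis rests on a single minimisation argument, \<open>resolvent_exists\<close>. Applied to a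
  linear functional it gives the Riesz representation and so the adjoint of \<open>K\<close>; applied to an
  indicator functional it gives projections to closed convex sets, from which weak lower semicontinuity and weak sequential
  compactness of bounded sequences follow.
\<close>

section \<open>Proper convex functionals\<close>

lemma proper_finite:
  assumes "proper F" "u \<in> eff_dom F"
  shows "F u = ereal (real_of_ereal (F u))"
  using assms by (auto simp: proper_def eff_dom_def ereal_real)

lemma in_eff_dom_if_le: "F u \<le> ereal c \<Longrightarrow> u \<in> eff_dom F"
  by (cases "F u") (auto simp: eff_dom_def)

lemma convex_on_eff_dom:
  assumes "proper F" "convex_fun F"
  shows "convex_on (eff_dom F) (\<lambda>u. real_of_ereal (F u))"
proof -
  have key: "F (a *\<^sub>R u + b *\<^sub>R v) \<le> ereal (a * real_of_ereal (F u) + b * real_of_ereal (F v))"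
    if "u \<in> eff_dom F" "v \<in> eff_dom F" "a \<ge> 0" "b \<ge> 0" "a + b = 1" for u v a b
  proof -
    have "F (a *\<^sub>R u + b *\<^sub>R v) \<le> ereal a * F u + ereal b * F v"
      using assms(2) that unfolding convex_fun_def by blast
    also have "\<dots> = ereal (a * real_of_ereal (F u) + b * real_of_ereal (F v))"
      using proper_finite[OF assms(1) that(1)] proper_finite[OF assms(1) that(2)]
      by (metis plus_ereal.simps(1) times_ereal.simps(1))
    finally show ?thesis .
  qed
  show ?thesis
    unfolding convex_on_def convex_def
  proof (intro conjI ballI allI impI)
    fix u v a b
    assume *: "u \<in> eff_dom F" "v \<in> eff_dom F" "(0::real) \<le> a" "(0::real) \<le> b" "a + b = 1"
    show 1: "a *\<^sub>R u + b *\<^sub>R v \<in> eff_dom F"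
      using key[OF *] by (rule in_eff_dom_if_le)
    show "real_of_ereal (F (a *\<^sub>R u + b *\<^sub>R v))
        \<le> a * real_of_ereal (F u) + b * real_of_ereal (F v)"
      using key[OF *] proper_finite[OF assms(1) 1] by (metis ereal_less_eq(3))
  qed
qed

lemma lsc_eventually:
  assumes "lower_semicontinuous F" "a < F u"
  shows "eventually (\<lambda>w. a < F w) (nhds u)"
proof -
  have "a < Liminf (at u) F"
    using assms unfolding lower_semicontinuous_def by (meson order_less_le_trans)
  from less_LiminfD[OF this] show ?thesis
    using assms(2) by (auto simp: eventually_at_filter elim: eventually_mono)
qed

lemma lsc_limit_le:
  assumes lsc: "lower_semicontinuous F" and u: "u \<longlonglongrightarrow> l"
    and c: "c \<longlonglongrightarrow> c'" and le: "\<And>n. F (u n) \<le> ereal (c n)"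
  shows "F l \<le> ereal c'"
proof (rule dense_le)
  fix a assume "a < F l"
  then have "eventually (\<lambda>n. a < F (u n)) sequentially"
    using lsc_eventually[OF lsc] u unfolding filterlim_iff by blast
  then have "eventually (\<lambda>n. a \<le> ereal (c n)) sequentially"
    using le by (auto elim!: eventually_mono dest: less_imp_le intro: order_trans)
  then show "a \<le> ereal c'"
    using tendsto_lowerbound[of "\<lambda>n. ereal (c n)" "ereal c'" sequentially a] c by simp
qed

lemma lsc_closed_sublevel:
  assumes "lower_semicontinuous F"
  shows "closed {u. F u \<le> a}"
proof -
  have "{u. F u \<le> a} = - {u. a < F u}" by auto
  moreover have "open {u. a < F u}"
    unfolding open_subopen[of "{u. a < F u}"]
    using lsc_eventually[OF assms] unfolding eventually_nhds by (metis mem_Collect_eq subset_eq)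
  ultimately show ?thesis by (simp add: closed_def)
qed

lemma subdifferential_eff_dom:
  assumes "proper F" "g \<in> subdifferential F u"
  shows "u \<in> eff_dom F"
proof -
  obtain z where "z \<in> eff_dom F" using assms(1) by (auto simp: proper_def)
  moreover have "F u + ereal (g \<bullet> (z - u)) \<le> F z"
    using assms(2) by (auto simp: subdifferential_def)
  ultimately show ?thesis
    by (cases "F u") (auto simp: eff_dom_def)
qed

lemma subgradient_ineq:
  assumes "proper F" "g \<in> subdifferential F u" "z \<in> eff_dom F"
  shows "real_of_ereal (F u) + g \<bullet> (z - u) \<le> real_of_ereal (F z)"
proof -
  have "F u + ereal (g \<bullet> (z - u)) \<le> F z"
    using assms(2) by (auto simp: subdifferential_def)
  then show ?thesis
    using proper_finite[OF assms(1) subdifferential_eff_dom[OF assms(1,2)]] proper_finite[OF assms(1,3)]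
    by (metis ereal_less_eq(3) plus_ereal.simps(1))
qed

lemma subgradientI:
  assumes "proper F" "u \<in> eff_dom F"
    and "\<And>z. z \<in> eff_dom F \<Longrightarrow> real_of_ereal (F u) + g \<bullet> (z - u) \<le> real_of_ereal (F z)"
  shows "g \<in> subdifferential F u"
  unfolding subdifferential_def
proof (intro CollectI allI)
  fix z show "F u + ereal (g \<bullet> (z - u)) \<le> F z"
  proof (cases "z \<in> eff_dom F")
    case True
    then show ?thesis
      using proper_finite[OF assms(1,2)] proper_finite[OF assms(1) True] assms(3)[OF True]
      by (metis ereal_less_eq(3) plus_ereal.simps(1))
  next
    case False
    then show ?thesis by (simp add: eff_dom_def)
  qed
qed

section \<open>Existence and nonexpansiveness of the resolvent\<close>

text \<open>
  Lower semicontinuity bounds \<open>F\<close> below on a small ball around a point \<open>p\<close> of the effective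
  domain. If \<open>F\<close> fell faster than linearly further out, the chord from \<open>p\<close> would by convexity
  violate that bound where it leaves the ball.
\<close>

lemma convex_lsc_lower_bound:
  fixes F :: "'a::real_normed_vector \<Rightarrow> ereal"
  assumes "proper F" "convex_fun F" "lower_semicontinuous F"
  obtains a b where "b \<ge> 0" "\<And>u. u \<in> eff_dom F \<Longrightarrow> a - b * norm u \<le> real_of_ereal (F u)"
proof -
  let ?f = "\<lambda>u. real_of_ereal (F u)"
  obtain p where p: "p \<in> eff_dom F" using assms(1) by (auto simp: proper_def)
  have "ereal (?f p - 1) < F p"
    by (subst (2) proper_finite[OF assms(1) p]) simp
  from lsc_eventually[OF assms(3) this]
  obtain r where r: "r > 0" "\<And>w. dist w p < r \<Longrightarrow> ereal (?f p - 1) < F w"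
    unfolding eventually_nhds_metric by blast
  define s where "s = r / 2"
  have s: "s > 0" using r by (simp add: s_def)
  have near: "?f p - 1 \<le> ?f w" if "w \<in> eff_dom F" "dist w p \<le> s" for w
  proof -
    have "ereal (?f p - 1) < ereal (?f w)"
      using r(2)[of w] that r(1) proper_finite[OF assms(1) that(1)] by (simp add: s_def)
    then show ?thesis by simp
  qed
  have main: "?f p - 1 - norm (u - p) / s \<le> ?f u" if u: "u \<in> eff_dom F" for u
  proof (cases "norm (u - p) \<le> s")
    case True
    then have "?f p - 1 \<le> ?f u" using near[OF u] by (simp add: dist_norm)
    then show ?thesis using s by (smt (verit) divide_nonneg_pos norm_ge_zero)
  next
    case False
    define t where "t = s / norm (u - p)"
    have t: "0 < t" "t \<le> 1" using False s by (auto simp: t_def divide_simps)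
    let ?w = "(1 - t) *\<^sub>R p + t *\<^sub>R u"
    have w: "?w \<in> eff_dom F"
      using convex_on_eff_dom[OF assms(1,2)] p u t
      by (auto simp: convex_on_def convex_alt)
    have "?w - p = t *\<^sub>R (u - p)" by (simp add: algebra_simps)
    then have "dist ?w p = t * norm (u - p)" using t by (simp add: dist_norm)
    also have "\<dots> = s" using False s by (auto simp: t_def)
    finally have "?f p - 1 \<le> ?f ?w" using near[OF w] by simp
    also have "?f ?w \<le> (1 - t) * ?f p + t * ?f u"
      using convex_onD[OF convex_on_eff_dom[OF assms(1,2)], of t p u] t p u by simp
    finally have "t * (?f p - 1 / t) \<le> t * ?f u" using t by (simp add: algebra_simps)
    then have "?f p - 1 / t \<le> ?f u" using t by simp
    moreover have "1 / t = norm (u - p) / s" by (simp add: t_def)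
    ultimately show ?thesis by linarith
  qed
  show thesis
  proof (rule that[of "1 / s" "?f p - 1 - norm p / s"])
    show "1 / s \<ge> 0" using s by simp
    fix u assume u: "u \<in> eff_dom F"
    have "norm (u - p) / s \<le> norm u / s + norm p / s"
      using s norm_triangle_ineq4[of u p] by (simp add: add_divide_distrib[symmetric] divide_right_mono)
    then show "?f p - 1 - norm p / s - 1 / s * norm u \<le> ?f u"
      using main[OF u] by simp
  qed
qed

text \<open>
  A point \<open>p\<close> solves \<open>p + s g = z\<close> with a subgradient \<open>g\<close> at \<open>p\<close> as soon as it minimises
  \<open>J u = F u + \<parallel>u - z\<parallel>\<^sup>2 / (2 s)\<close>. The quadratic term beats the linear lower bound on \<open>F\<close>, so \<open>J\<close> is
  bounded below; by the parallelogram identity \<open>J\<close> is strongly convex, which makes every minimising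
  sequence Cauchy, and lower semicontinuity passes to its limit.
\<close>

lemma resolvent_exists:
  fixes F :: "'a::{real_inner, complete_space} \<Rightarrow> ereal"
  assumes F: "proper F" "convex_fun F" "lower_semicontinuous F" and s: "s > 0"
  shows "\<exists>p. \<exists>g\<in>subdifferential F p. p + s *\<^sub>R g = z"
proof -
  let ?f = "\<lambda>u. real_of_ereal (F u)"
  let ?D = "eff_dom F"
  define J where "J u = ?f u + (norm (u - z))\<^sup>2 / (2 * s)" for u
  note cvx = convex_on_eff_dom[OF F(1,2)]
  have cD: "convex ?D" using cvx by (rule convex_on_imp_convex)
  have ne: "?D \<noteq> {}" using F(1) by (simp add: proper_def)
  have "bdd_below (J ` ?D)"
  proof -
    obtain a b where ab: "b \<ge> 0" "\<And>u. u \<in> ?D \<Longrightarrow> a - b * norm u \<le> ?f u"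
      by (rule convex_lsc_lower_bound[OF F]) (rule that)
    have "a - b * norm z - s * b\<^sup>2 / 2 \<le> J u" if u: "u \<in> ?D" for u
    proof -
      have "b * norm u \<le> b * (norm (u - z) + norm z)"
        using ab(1) by (intro mult_left_mono) (auto simp: norm_triangle_sub add.commute)
      \<comment> \<open>Young's inequality absorbs the linear term.\<close>
      moreover have "0 \<le> (norm (u - z) - s * b)\<^sup>2 / (2 * s)" using s by simp
      then have "b * norm (u - z) \<le> (norm (u - z))\<^sup>2 / (2 * s) + s * b\<^sup>2 / 2"
        using s by (simp add: power2_eq_square field_simps)
      ultimately show ?thesis using ab(2)[OF u] by (simp add: J_def algebra_simps)
    qed
    then show ?thesis by (intro bdd_belowI2)
  qed
  define m where "m = (INF u\<in>?D. J u)"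
  have m_le: "m \<le> J u" if "u \<in> ?D" for u
    unfolding m_def using \<open>bdd_below _\<close> that by (rule cINF_lower)
  have "\<exists>u\<in>?D. J u < m + 1 / real (Suc n)" for n
  proof -
    have "m < m + 1 / real (Suc n)" by simp
    then show ?thesis
      unfolding m_def cINF_less_iff[OF ne \<open>bdd_below _\<close>] .
  qed
  then obtain u where u: "\<And>n. u n \<in> ?D" "\<And>n. J (u n) < m + 1 / real (Suc n)" by metis
  \<comment> \<open>Strong convexity: compare \<open>m\<close> with the value of \<open>J\<close> at the midpoint of \<open>v\<close> and \<open>w\<close>.\<close>
  have par: "(norm (v - w))\<^sup>2 \<le> 4 * s * ((J v - m) + (J w - m))" if v: "v \<in> ?D" and w: "w \<in> ?D" for v w
  proof -
    let ?h = "(1 - 1/2) *\<^sub>R v + (1/2) *\<^sub>R w"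
    have h: "?h \<in> ?D" by (rule convexD_alt[OF cD v w]) auto
    have "?f ?h \<le> (1 - 1/2) * ?f v + (1/2) * ?f w"
      by (rule convex_onD[OF cvx]) (use v w in auto)
    moreover have "(norm (?h - z))\<^sup>2 = (norm (v - z))\<^sup>2 / 2 + (norm (w - z))\<^sup>2 / 2 - (norm (v - w))\<^sup>2 / 4"
      unfolding power2_norm_eq_inner by (simp add: inner_simps inner_commute) (simp add: field_simps)
    then have "(norm (?h - z))\<^sup>2 / (2 * s) =
        (norm (v - z))\<^sup>2 / (2 * s) / 2 + (norm (w - z))\<^sup>2 / (2 * s) / 2 - (norm (v - w))\<^sup>2 / (2 * s) / 4"
      by (simp only: add_divide_distrib diff_divide_distrib) (simp add: mult.commute)
    ultimately have "m \<le> J v / 2 + J w / 2 - (norm (v - w))\<^sup>2 / (8 * s)"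
      using m_le[OF h] unfolding J_def by (simp add: add_divide_distrib)
    then show ?thesis using s by (simp add: field_simps)
  qed
  have "Cauchy u"
  proof (rule metric_CauchyI)
    fix e :: real assume e: "e > 0"
    have "(\<lambda>n. 8 * s * (1 / real (Suc n))) \<longlonglongrightarrow> 8 * s * 0"
      by (intro tendsto_mult tendsto_const LIMSEQ_Suc lim_1_over_n)
    then have "eventually (\<lambda>n. 8 * s * (1 / real (Suc n)) < e\<^sup>2) sequentially"
      by (rule order_tendstoD(2)) (use e in simp)
    then obtain N where N: "8 * s * (1 / real (Suc N)) < e\<^sup>2"
      by (auto simp: eventually_sequentially)
    have "dist (u i) (u j) < e" if "i \<ge> N" "j \<ge> N" for i j
    proof -
      have "J (u k) - m \<le> 1 / real (Suc N)" if "k \<ge> N" for k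
      proof -
        have "1 / real (Suc k) \<le> 1 / real (Suc N)" using that by (simp add: frac_le)
        then show ?thesis using u(2)[of k] by linarith
      qed
      from this[OF \<open>i \<ge> N\<close>] this[OF \<open>j \<ge> N\<close>]
      have "4 * s * ((J (u i) - m) + (J (u j) - m)) \<le> 4 * s * (1 / real (Suc N) + 1 / real (Suc N))"
        using s by (intro mult_left_mono add_mono) auto
      then have "(norm (u i - u j))\<^sup>2 < e\<^sup>2"
        using par[OF u(1) u(1), of i j] N by (simp add: algebra_simps)
      then show ?thesis using e by (simp add: dist_norm power_less_imp_less_base)
    qed
    then show "\<exists>N. \<forall>i\<ge>N. \<forall>j\<ge>N. dist (u i) (u j) < e" by blast
  qed
  then obtain p where p: "u \<longlonglongrightarrow> p" using Cauchy_convergent convergent_def by blast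
  have Fp: "F p \<le> ereal (m - (norm (p - z))\<^sup>2 / (2 * s))"
  proof (rule lsc_limit_le[OF F(3) p])
    have "(\<lambda>n. m + 1 / real (Suc n) - (norm (u n - z))\<^sup>2 / (2 * s)) \<longlonglongrightarrow>
        m + 0 - (norm (p - z))\<^sup>2 / (2 * s)"
      using s by (intro tendsto_intros LIMSEQ_Suc lim_1_over_n p) auto
    then show "(\<lambda>n. m + 1 / real (Suc n) - (norm (u n - z))\<^sup>2 / (2 * s)) \<longlonglongrightarrow>
        m - (norm (p - z))\<^sup>2 / (2 * s)" by simp
    fix n
    have "?f (u n) \<le> m + 1 / real (Suc n) - (norm (u n - z))\<^sup>2 / (2 * s)"
      using u(2)[of n] by (simp add: J_def)
    then show "F (u n) \<le> ereal (m + 1 / real (Suc n) - (norm (u n - z))\<^sup>2 / (2 * s))"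
      by (subst proper_finite[OF F(1) u(1)]) simp
  qed
  then have pD: "p \<in> ?D" by (rule in_eff_dom_if_le)
  have Jp: "J p \<le> m"
    using Fp proper_finite[OF F(1) pD] unfolding J_def by (metis ereal_less_eq(3) le_diff_eq)
  \<comment> \<open>First-order optimality: move from \<open>p\<close> a fraction \<open>t\<close> towards \<open>v\<close>, divide by \<open>t\<close>, let \<open>t\<close> tend to 0.\<close>
  define g where "g = (1 / s) *\<^sub>R (z - p)"
  have "g \<in> subdifferential F p"
  proof (rule subgradientI[OF F(1) pD])
    fix v assume v: "v \<in> ?D"
    let ?q = "(norm (v - p))\<^sup>2 / (2 * s)"
    have gs: "(z - p) \<bullet> (v - p) = s * (g \<bullet> (v - p))" using s by (simp add: g_def)
    have "?f p + g \<bullet> (v - p) \<le> ?f v + t * ?q" if t: "0 < t" "t < 1" for t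
    proof -
      let ?w = "(1 - t) *\<^sub>R p + t *\<^sub>R v"
      have w: "?w \<in> ?D" using cD pD v t unfolding convex_alt by auto
      have "?f ?w \<le> (1 - t) * ?f p + t * ?f v"
        using t by (intro convex_onD[OF cvx] pD v) auto
      moreover have "(norm (?w - z))\<^sup>2 = (norm (p - z))\<^sup>2 - 2 * t * ((z - p) \<bullet> (v - p)) + t\<^sup>2 * (norm (v - p))\<^sup>2"
        unfolding power2_norm_eq_inner by (simp add: inner_simps inner_commute) (simp add: algebra_simps power2_eq_square)
      then have "(norm (?w - z))\<^sup>2 / (2 * s) = (norm (p - z))\<^sup>2 / (2 * s) - t * (g \<bullet> (v - p)) + t * (t * ?q)"
        using s unfolding gs by (simp add: field_simps power2_eq_square)
      ultimately have "0 \<le> t * (?f v - ?f p - g \<bullet> (v - p) + t * ?q)"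
        using Jp m_le[OF w] by (simp add: J_def algebra_simps)
      then show ?thesis using t by (simp add: zero_le_mult_iff)
    qed
    then have ev: "eventually (\<lambda>t. ?f p + g \<bullet> (v - p) \<le> ?f v + t * ?q) (at_right 0)"
      unfolding eventually_at_right_field by (metis zero_less_one)
    have lim: "((\<lambda>t. ?f v + t * ?q) \<longlongrightarrow> ?f v + 0 * ?q) (at_right 0)"
      by (intro tendsto_intros)
    show "?f p + g \<bullet> (v - p) \<le> ?f v"
      using tendsto_lowerbound[OF lim ev] by simp
  qed
  moreover have "p + s *\<^sub>R g = z" using s by (simp add: g_def)
  ultimately show ?thesis by blast
qed

text \<open>
  Monotonicity of the subdifferential makes the cross term in the expansion of the right-hand side
  nonnegative. The case of equal right-hand arguments is uniqueness of the resolvent; the general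
  case later bounds the iterates.
\<close>

lemma subdifferential_nonexpansive:
  assumes F: "proper F" and g: "g \<in> subdifferential F u" and h: "h \<in> subdifferential F v"
    and s: "s > 0"
  shows "norm (u - v) \<le> norm ((u + s *\<^sub>R g) - (v + s *\<^sub>R h))"
proof -
  have "0 \<le> (g - h) \<bullet> (u - v)"
    using subgradient_ineq[OF F g subdifferential_eff_dom[OF F h]]
      subgradient_ineq[OF F h subdifferential_eff_dom[OF F g]]
    by (simp add: inner_simps)
  then have "0 \<le> 2 * s * ((g - h) \<bullet> (u - v)) + s\<^sup>2 * (norm (g - h))\<^sup>2" using s by simp
  moreover have "(norm (a + s *\<^sub>R c))\<^sup>2 = (norm a)\<^sup>2 + (2 * s * (c \<bullet> a) + s\<^sup>2 * (norm c)\<^sup>2)" for a c :: 'a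
    unfolding power2_norm_eq_inner by (simp add: inner_simps inner_commute power2_eq_square)
  from this[of "u - v" "g - h"]
  have "(norm ((u + s *\<^sub>R g) - (v + s *\<^sub>R h)))\<^sup>2 =
      (norm (u - v))\<^sup>2 + (2 * s * ((g - h) \<bullet> (u - v)) + s\<^sup>2 * (norm (g - h))\<^sup>2)"
    by (simp add: algebra_simps)
  ultimately have "(norm (u - v))\<^sup>2 \<le> (norm ((u + s *\<^sub>R g) - (v + s *\<^sub>R h)))\<^sup>2" by linarith
  then show ?thesis by (rule power2_le_imp_le) simp
qed

lemma resolvent_subgradient:
  fixes F :: "'a::{real_inner, complete_space} \<Rightarrow> ereal"
  assumes F: "proper F" "convex_fun F" "lower_semicontinuous F" and s: "s > 0"
  shows "(1 / s) *\<^sub>R (z - resolvent s (subdifferential F) z)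
           \<in> subdifferential F (resolvent s (subdifferential F) z)"
proof -
  let ?P = "\<lambda>p. \<exists>g\<in>subdifferential F p. p + s *\<^sub>R g = z"
  have "\<exists>!p. ?P p"
    using resolvent_exists[OF F s, of z] subdifferential_nonexpansive[OF F(1) _ _ s]
    by (metis eq_iff_diff_eq_0 norm_le_zero_iff norm_zero)
  then have "?P (resolvent s (subdifferential F) z)"
    unfolding resolvent_def by (rule theI')
  then obtain g where g: "g \<in> subdifferential F (resolvent s (subdifferential F) z)"
    "resolvent s (subdifferential F) z + s *\<^sub>R g = z" by blast
  have "g = (1 / s) *\<^sub>R (z - resolvent s (subdifferential F) z)"
    using s by (subst g(2)[symmetric]) simp
  then show ?thesis using g(1) by simp
qed

section \<open>Riesz representation, adjoints and projections\<close>

lemma real_functional_convex_lsc: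
  fixes f :: "'a::real_inner \<Rightarrow> real"
  assumes f: "bounded_linear f"
  shows "proper (\<lambda>u. ereal (- f u))" "convex_fun (\<lambda>u. ereal (- f u))"
    "lower_semicontinuous (\<lambda>u. ereal (- f u))"
proof -
  interpret bounded_linear f by fact
  show "proper (\<lambda>u. ereal (- f u))" by (auto simp: proper_def eff_dom_def)
  show "convex_fun (\<lambda>u. ereal (- f u))" by (auto simp: convex_fun_def add scale)
  have "Liminf (at u) (\<lambda>w. ereal (- f w)) = ereal (- f u)" if "at u \<noteq> bot" for u
  proof (rule lim_imp_Liminf[OF that])
    have "((\<lambda>w. - f w) \<longlongrightarrow> - f u) (at u)"
      by (intro tendsto_minus tendsto tendsto_ident_at)
    then show "((\<lambda>w. ereal (- f w)) \<longlongrightarrow> ereal (- f u)) (at u)" by simp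
  qed
  then show "lower_semicontinuous (\<lambda>u. ereal (- f u))"
    unfolding lower_semicontinuous_def by (metis Liminf_bot order_refl top_greatest)
qed

text \<open>
  Minimising \<open>\<parallel>u\<parallel>\<^sup>2 / 2 - f u\<close>, that is, taking the resolvent of the convex functional \<open>- f\<close>
  at \<open>0\<close>: its only subgradient is the vector representing \<open>- f\<close>.
\<close>

theorem riesz_representation:
  fixes f :: "'a::{real_inner, complete_space} \<Rightarrow> real"
  assumes f: "bounded_linear f"
  obtains a where "\<And>u. f u = u \<bullet> a"
proof -
  interpret bounded_linear f by fact
  obtain p g where g: "g \<in> subdifferential (\<lambda>u. ereal (- f u)) p" "p + 1 *\<^sub>R g = 0"
    using resolvent_exists[OF real_functional_convex_lsc[OF f] zero_less_one, of 0]
    by (elim exE bexE)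
  have le: "g \<bullet> v \<le> - f v" for v
  proof -
    have "ereal (- f p) + ereal (g \<bullet> ((p + v) - p)) \<le> ereal (- f (p + v))"
      using g(1) unfolding subdifferential_def by blast
    then show ?thesis by (simp add: add)
  qed
  have "f u = u \<bullet> (- g)" for u
    using le[of u] le[of "- u"] by (simp add: neg inner_commute)
  then show thesis by (rule that)
qed

lemma adjoint_inner:
  fixes K :: "'a::{real_inner, complete_space} \<Rightarrow> 'b::real_inner"
  assumes K: "bounded_linear K"
  shows "K u \<bullet> v = u \<bullet> adjoint K v"
proof -
  have "\<exists>w. \<forall>u. K u \<bullet> v = u \<bullet> w" for v
    using riesz_representation[OF bounded_linear_compose[OF bounded_linear_inner_left K], of v]
    by metis
  then have "\<exists>K'. \<forall>u v. K u \<bullet> v = u \<bullet> K' v" by metis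
  then show ?thesis unfolding adjoint_def by (rule someI2_ex) blast
qed

lemma bounded_linear_adjoint:
  fixes K :: "'a::{real_inner, complete_space} \<Rightarrow> 'b::real_inner"
  assumes K: "bounded_linear K"
  shows "bounded_linear (adjoint K)"
proof -
  obtain C where C: "C > 0" "\<And>u. norm (K u) \<le> norm u * C"
    using bounded_linear.pos_bounded[OF K] by blast
  note eqI = vector_eq_ldot[THEN iffD1]
  show ?thesis
  proof (rule bounded_linear_intro)
    fix v w show "adjoint K (v + w) = adjoint K v + adjoint K w"
      by (rule eqI) (simp add: inner_add_right flip: adjoint_inner[OF K])
    fix r show "adjoint K (r *\<^sub>R v) = r *\<^sub>R adjoint K v"
      by (rule eqI) (simp flip: adjoint_inner[OF K])
    show "norm (adjoint K v) \<le> norm v * C"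
    proof (cases "adjoint K v = 0")
      case False
      have "(norm (adjoint K v))\<^sup>2 = K (adjoint K v) \<bullet> v"
        by (simp add: power2_norm_eq_inner adjoint_inner[OF K])
      also have "\<dots> \<le> norm (K (adjoint K v)) * norm v" by (rule norm_cauchy_schwarz)
      also have "\<dots> \<le> (norm (adjoint K v) * C) * norm v"
        using C(2) by (intro mult_right_mono) auto
      finally show ?thesis using False by (simp add: power2_eq_square mult.assoc mult.commute)
    qed (use C in auto)
  qed
qed

text \<open>
  The projection is the resolvent of the indicator functional of \<open>C\<close>, and the obtuse-angle
  inequality is the subgradient inequality for that functional.
\<close>

lemma projection_exists:
  fixes C :: "'a::{real_inner, complete_space} set"
  assumes "closed C" "convex C" "C \<noteq> {}"
  obtains p where "p \<in> C" "\<And>c. c \<in> C \<Longrightarrow> (z - p) \<bullet> (c - p) \<le> 0"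
proof -
  define F :: "'a \<Rightarrow> ereal" where "F u = (if u \<in> C then 0 else \<infinity>)" for u
  have dom: "eff_dom F = C" by (auto simp: eff_dom_def F_def)
  have "proper F" using assms(3) dom by (auto simp: proper_def F_def)
  have "convex_fun F"
    unfolding convex_fun_def
  proof (intro allI impI)
    fix u v and a b :: real assume ab: "0 \<le> a" "0 \<le> b" "a + b = 1"
    show "F (a *\<^sub>R u + b *\<^sub>R v) \<le> ereal a * F u + ereal b * F v"
    proof (cases "u \<in> C \<and> v \<in> C")
      case True
      then show ?thesis using convexD[OF assms(2) _ _ ab] by (simp add: F_def)
    next
      case False
      show ?thesis
      proof (cases "a = 0 \<or> b = 0")
        case True
        then show ?thesis using ab by (auto simp: zero_ereal_def[symmetric] one_ereal_def[symmetric])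
      next
        case False
        with \<open>\<not> (u \<in> C \<and> v \<in> C)\<close> ab show ?thesis by (auto simp: F_def)
      qed
    qed
  qed
  have "lower_semicontinuous F"
    unfolding lower_semicontinuous_def
  proof
    fix u show "F u \<le> Liminf (at u) F"
    proof (cases "u \<in> C")
      case True
      then show ?thesis by (auto intro!: Liminf_bounded simp: F_def)
    next
      case False
      then have "eventually (\<lambda>w. w \<in> - C) (at u)"
        using assms(1) by (intro eventually_at_topological[THEN iffD2]) auto
      then have "eventually (\<lambda>w. \<infinity> \<le> F w) (at u)"
        by (rule eventually_mono) (simp add: F_def)
      then have "\<infinity> \<le> Liminf (at u) F" by (rule Liminf_bounded)
      then show ?thesis by (simp add: F_def)
    qed
  qed
  obtain p g where g: "g \<in> subdifferential F p" "p + 1 *\<^sub>R g = z"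
    using resolvent_exists[OF \<open>proper F\<close> \<open>convex_fun F\<close> \<open>lower_semicontinuous F\<close> zero_less_one, of z]
    by (elim exE bexE)
  then have "p \<in> C" using subdifferential_eff_dom[OF \<open>proper F\<close>] dom by blast
  moreover have "(z - p) \<bullet> (c - p) \<le> 0" if "c \<in> C" for c
  proof -
    have "g = z - p" using g(2) by (auto simp: algebra_simps)
    then show ?thesis
      using subgradient_ineq[OF \<open>proper F\<close> g(1), of c] that \<open>p \<in> C\<close> dom by (simp add: F_def)
  qed
  ultimately show thesis by (rule that)
qed

section \<open>Weak convergence\<close>

lemma weakly_convergent_toI:
  fixes u :: "nat \<Rightarrow> 'a::{real_inner, complete_space}"
  assumes "\<And>v. (\<lambda>n. u n \<bullet> v) \<longlonglongrightarrow> l \<bullet> v"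
  shows "weakly_convergent_to u l"
  unfolding weakly_convergent_to_def
proof (intro allI impI)
  fix f :: "'a \<Rightarrow> real" assume "bounded_linear f"
  then obtain a where "\<And>w. f w = w \<bullet> a" by (rule riesz_representation) (rule that)
  then show "(\<lambda>n. f (u n)) \<longlonglongrightarrow> f l" using assms by simp
qed

lemma weakly_convergent_toD:
  assumes "weakly_convergent_to u l" "bounded_linear f"
  shows "(\<lambda>n. f (u n) :: real) \<longlonglongrightarrow> f l"
  using assms by (simp add: weakly_convergent_to_def)

text \<open>
  Let \<open>p\<close> be the projection of the weak limit \<open>l\<close> to \<open>C\<close>. The functional \<open>(l - p) \<bullet> _\<close> is at most
  \<open>(l - p) \<bullet> p\<close> on \<open>C\<close>, so also at \<open>l\<close>, which leaves \<open>\<parallel>l - p\<parallel>\<^sup>2 \<le> 0\<close>.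
\<close>

lemma closed_convex_weakly_closed:
  fixes C :: "'a::{real_inner, complete_space} set"
  assumes C: "closed C" "convex C" and u: "weakly_convergent_to u l"
    and freq: "\<exists>\<^sub>F n in sequentially. u n \<in> C"
  shows "l \<in> C"
proof -
  have "C \<noteq> {}" using freq by (auto dest: frequently_ex)
  then obtain p where p: "p \<in> C" "\<And>c. c \<in> C \<Longrightarrow> (l - p) \<bullet> (c - p) \<le> 0"
    using projection_exists[OF C] by metis
  have lim: "(\<lambda>n. (l - p) \<bullet> u n - (l - p) \<bullet> p) \<longlonglongrightarrow> (l - p) \<bullet> l - (l - p) \<bullet> p"
    by (intro tendsto_diff tendsto_const weakly_convergent_toD[OF u] bounded_linear_inner_right)
  have "\<not> 0 < (l - p) \<bullet> l - (l - p) \<bullet> p"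
  proof
    assume "0 < (l - p) \<bullet> l - (l - p) \<bullet> p"
    then have "eventually (\<lambda>n. 0 < (l - p) \<bullet> u n - (l - p) \<bullet> p) sequentially"
      by (rule order_tendstoD(1)[OF lim])
    then obtain n where "u n \<in> C" "0 < (l - p) \<bullet> u n - (l - p) \<bullet> p"
      using frequently_ex[OF frequently_eventually_frequently[OF freq]] by blast
    then show False using p(2)[of "u n"] by (simp add: inner_diff_right)
  qed
  then have "(l - p) \<bullet> (l - p) \<le> 0" by (simp add: inner_diff_right)
  then have "l = p" by (metis inner_gt_zero_iff eq_iff_diff_eq_0 not_le)
  then show ?thesis using p(1) by simp
qed

text \<open>
  Convex lower semicontinuous functionals have closed convex sublevel sets.
\<close>

lemma weakly_lsc:
  fixes F :: "'a::{real_inner, complete_space} \<Rightarrow> ereal"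
  assumes F: "convex_fun F" "lower_semicontinuous F"
    and u: "weakly_convergent_to u l" and a: "ereal a < F l"
  shows "eventually (\<lambda>n. ereal a < F (u n)) sequentially"
proof (rule ccontr)
  assume "\<not> ?thesis"
  then have "\<exists>\<^sub>F n in sequentially. u n \<in> {w. F w \<le> ereal a}"
    by (simp add: frequently_def not_le)
  moreover have "convex {w. F w \<le> ereal a}"
    unfolding convex_def
  proof (intro ballI allI impI, simp only: mem_Collect_eq)
    fix v w and s t :: real
    assume *: "F v \<le> ereal a" "F w \<le> ereal a" "0 \<le> s" "0 \<le> t" "s + t = 1"
    have "F (s *\<^sub>R v + t *\<^sub>R w) \<le> ereal s * F v + ereal t * F w"
      using F(1) * unfolding convex_fun_def by blast
    also have "\<dots> \<le> ereal s * ereal a + ereal t * ereal a"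
      using * by (intro add_mono ereal_mult_left_mono) auto
    also have "\<dots> = ereal a" using * by (simp flip: distrib_right)
    finally show "F (s *\<^sub>R v + t *\<^sub>R w) \<le> ereal a" .
  qed
  ultimately have "F l \<le> ereal a"
    using closed_convex_weakly_closed[OF lsc_closed_sublevel[OF F(2)] _ u] by blast
  with a show False by simp
qed

text \<open>
  A uniform bound on \<open>u\<close> makes the functionals \<open>u n \<bullet> _\<close> equicontinuous, so that the Cauchy
  property of \<open>u n \<bullet> v\<close> survives limits in \<open>v\<close>.
\<close>

lemma convergent_inner_closed:
  fixes u :: "nat \<Rightarrow> 'a::real_inner"
  assumes B: "\<And>n. norm (u n) \<le> B"
  shows "closed {v. convergent (\<lambda>n. u n \<bullet> v)}"
proof (unfold closed_sequential_limits, intro allI impI, elim conjE)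
  fix w v assume w: "\<forall>k. w k \<in> {v. convergent (\<lambda>n. u n \<bullet> v)}" and lim: "w \<longlonglongrightarrow> v"
  have B0: "B \<ge> 0" using B[of 0] norm_ge_zero[of "u 0"] by linarith
  have "Cauchy (\<lambda>n. u n \<bullet> v)"
  proof (rule metric_CauchyI)
    fix e :: real assume e: "e > 0"
    then have "e / (3 * (B + 1)) > 0" using B0 by simp
    from metric_LIMSEQ_D[OF lim this] obtain k where k: "dist (w k) v < e / (3 * (B + 1))" by blast
    have near: "\<bar>u n \<bullet> v - u n \<bullet> w k\<bar> < e / 3" for n
    proof -
      have "\<bar>u n \<bullet> v - u n \<bullet> w k\<bar> \<le> norm (u n) * norm (v - w k)"
        using Cauchy_Schwarz_ineq2[of "u n" "v - w k"] by (simp add: inner_diff_right)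
      also have "\<dots> \<le> (B + 1) * norm (v - w k)"
        using B[of n] by (intro mult_right_mono) auto
      also have "\<dots> < (B + 1) * (e / (3 * (B + 1)))"
        using k B0 by (intro mult_strict_left_mono) (auto simp: dist_norm norm_minus_commute)
      also have "\<dots> = e / 3" using B0 by (simp add: field_simps)
      finally show ?thesis .
    qed
    have "Cauchy (\<lambda>n. u n \<bullet> w k)" using w by (simp add: Cauchy_convergent_iff)
    then obtain N where N: "\<And>m n. m \<ge> N \<Longrightarrow> n \<ge> N \<Longrightarrow> \<bar>u m \<bullet> w k - u n \<bullet> w k\<bar> < e / 3"
      using e unfolding Cauchy_def dist_real_def by (metis divide_pos_pos zero_less_numeral)
    have "dist (u m \<bullet> v) (u n \<bullet> v) < e" if "m \<ge> N" "n \<ge> N" for m n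
      using near[of m] near[of n] N[OF that] unfolding dist_real_def by linarith
    then show "\<exists>N. \<forall>m\<ge>N. \<forall>n\<ge>N. dist (u m \<bullet> v) (u n \<bullet> v) < e" by blast
  qed
  then show "v \<in> {v. convergent (\<lambda>n. u n \<bullet> v)}" by (simp add: Cauchy_convergent_iff)
qed

text \<open>
  A diagonal argument gives a subsequence along which the inner products with every single \<open>u m\<close>
  converge. The vectors \<open>v\<close> for which \<open>u (r n) \<bullet> v\<close> converges form a closed subspace \<open>S\<close> containing
  all \<open>u m\<close>. For arbitrary \<open>v\<close> with projection \<open>p\<close> to \<open>S\<close>, the residual \<open>v - p\<close> is
  orthogonal to all \<open>u m\<close>, so its inner products vanish and it belongs to \<open>S\<close> as well; hence \<open>S\<close> is
  the whole space. The Riesz representative of the pointwise limit is the weak limit.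
\<close>

theorem bounded_weakly_convergent_subseq:
  fixes u :: "nat \<Rightarrow> 'a::{real_inner, complete_space}"
  assumes "bounded (range u)"
  obtains r l where "strict_mono r" "weakly_convergent_to (\<lambda>n. u (r n)) l"
proof -
  obtain B where B: "\<And>n. norm (u n) \<le> B" using assms by (auto simp: bounded_iff)
  interpret subseqs "\<lambda>m s. convergent (\<lambda>n. u (s n) \<bullet> u m)"
  proof
    fix m and s :: "nat \<Rightarrow> nat"
    have "\<bar>u (s n) \<bullet> u m\<bar> \<le> B * norm (u m)" for n
      using Cauchy_Schwarz_ineq2[of "u (s n)" "u m"] B[of "s n"]
      by (meson mult_right_mono norm_ge_zero order_trans)
    then have "bounded (range (\<lambda>n. u (s n) \<bullet> u m))" by (auto simp: bounded_iff)
    then show "\<exists>r'. strict_mono r' \<and> convergent (\<lambda>n. u ((s \<circ> r') n) \<bullet> u m)"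
      using bounded_imp_convergent_subsequence[of "\<lambda>n. u (s n) \<bullet> u m"] by (auto simp: convergent_def o_def)
  qed
  define r where "r = diagseq"
  define S where "S = {v. convergent (\<lambda>n. u (r n) \<bullet> v)}"
  have mono: "strict_mono r" unfolding r_def by (rule subseq_diagseq)
  have uS: "u m \<in> S" for m
  proof -
    have "convergent (\<lambda>n. u ((diagseq \<circ> (+) (Suc m)) n) \<bullet> u m)"
    proof (rule diagseq_holds)
      fix q s :: "nat \<Rightarrow> nat" and k
      assume "strict_mono q" "convergent (\<lambda>n. u (s n) \<bullet> u k)"
      then show "convergent (\<lambda>n. u ((s \<circ> q) n) \<bullet> u k)"
        using convergent_subseq_convergent[of "\<lambda>n. u (s n) \<bullet> u k" q] by (simp add: o_def)
    qed
    then have "convergent (\<lambda>n. u (r (n + Suc m)) \<bullet> u m)"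
      by (simp add: r_def add.commute)
    then show ?thesis
      unfolding S_def using convergent_ignore_initial_segment[of "\<lambda>n. u (r n) \<bullet> u m" "Suc m"] by simp
  qed
  have S_add: "v + w \<in> S" if "v \<in> S" "w \<in> S" for v w
    using that by (simp add: S_def inner_add_right convergent_add)
  have S_scale: "c *\<^sub>R v \<in> S" if "v \<in> S" for v c
    using that convergent_mult[OF convergent_const[of c]] by (simp add: S_def)
  have S0: "0 \<in> S" using S_scale[OF uS, of 0] by simp
  have cS: "closed S" unfolding S_def using B by (intro convergent_inner_closed)
  have "convex S" unfolding convex_def using S_add S_scale by blast
  have S_UNIV: "v \<in> S" for v
  proof -
    obtain p where p: "p \<in> S" "\<And>c. c \<in> S \<Longrightarrow> (v - p) \<bullet> (c - p) \<le> 0"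
      using projection_exists[OF cS \<open>convex S\<close>] S0 by blast
    have le: "(v - p) \<bullet> c \<le> 0" if "c \<in> S" for c
      using p(2)[OF S_add[OF p(1) that]] by simp
    have "u (r n) \<bullet> (v - p) = 0" for n
      using le[OF uS[of "r n"]] le[OF S_scale[OF uS[of "r n"], of "-1"]] by (simp add: inner_commute)
    then have "v - p \<in> S" by (simp add: S_def convergent_const)
    then show ?thesis using S_add[OF p(1)] by fastforce
  qed
  define L where "L v = lim (\<lambda>n. u (r n) \<bullet> v)" for v
  have L: "(\<lambda>n. u (r n) \<bullet> v) \<longlonglongrightarrow> L v" for v
    using S_UNIV[of v] by (simp add: S_def L_def convergent_LIMSEQ_iff)
  have "bounded_linear L"
  proof (rule bounded_linear_intro)
    fix v w show "L (v + w) = L v + L w"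
      by (rule LIMSEQ_unique[OF L]) (simp add: inner_add_right tendsto_add L)
    fix c show "L (c *\<^sub>R v) = c *\<^sub>R L v"
      by (rule LIMSEQ_unique[OF L]) (simp add: tendsto_mult_left L)
    have "norm (u (r n) \<bullet> v) \<le> norm v * B" for n
      using Cauchy_Schwarz_ineq2[of "u (r n)" v] B[of "r n"]
      by (metis mult.commute mult_right_mono norm_ge_zero order_trans real_norm_def)
    then show "norm (L v) \<le> norm v * B"
      by (intro tendsto_upperbound[OF tendsto_norm[OF L]]) auto
  qed
  then obtain l where "\<And>v. L v = v \<bullet> l" by (rule riesz_representation) blast
  then have "weakly_convergent_to (\<lambda>n. u (r n)) l"
    using L by (intro weakly_convergent_toI) (simp add: inner_commute)
  with mono show thesis by (rule that)
qed

text \<open>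
  Opial's lemma in a form that only speaks of functionals: a bounded sequence has weak cluster points,
  and two distinct ones would be distinguished by a functional that has only one limit along the
  sequence. In the classical case \<open>f\<close> is the inner product with \<open>s - t\<close>, and it converges because the
  distances to \<open>s\<close> and \<open>t\<close> do.
\<close>

theorem opial_separating_functionals:
  fixes u :: "nat \<Rightarrow> 'a::{real_inner, complete_space}"
  assumes bdd: "bounded (range u)"
    and cluster: "\<And>r l. strict_mono r \<Longrightarrow> weakly_convergent_to (\<lambda>n. u (r n)) l \<Longrightarrow> l \<in> S"
    and sep: "\<And>s t. s \<in> S \<Longrightarrow> t \<in> S \<Longrightarrow> s \<noteq> t \<Longrightarrow>
      \<exists>f :: 'a \<Rightarrow> real. bounded_linear f \<and> f s \<noteq> f t \<and> convergent (\<lambda>n. f (u n))"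
  obtains l where "l \<in> S" "weakly_convergent_to u l"
proof -
  obtain r0 l where r0: "strict_mono r0" and l: "weakly_convergent_to (\<lambda>n. u (r0 n)) l"
    using bounded_weakly_convergent_subseq[OF bdd] by blast
  have lS: "l \<in> S" using cluster[OF r0 l] .
  have unique: "l' = l" if r: "strict_mono r" and l': "weakly_convergent_to (\<lambda>n. u (r n)) l'" for r l'
  proof (rule ccontr)
    assume "l' \<noteq> l"
    from sep[OF cluster[OF r l'] lS this]
    obtain f :: "'a \<Rightarrow> real" and c
      where f: "bounded_linear f" "f l' \<noteq> f l" "(\<lambda>n. f (u n)) \<longlonglongrightarrow> c"
      by (auto simp: convergent_def)
    have "f l' = c"
      using LIMSEQ_unique[OF weakly_convergent_toD[OF l' f(1)]] LIMSEQ_subseq_LIMSEQ[OF f(3) r]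
      by (simp add: o_def)
    moreover have "f l = c"
      using LIMSEQ_unique[OF weakly_convergent_toD[OF l f(1)]] LIMSEQ_subseq_LIMSEQ[OF f(3) r0]
      by (simp add: o_def)
    ultimately show False using f(2) by simp
  qed
  have "weakly_convergent_to u l"
  proof (rule ccontr)
    assume "\<not> ?thesis"
    then obtain f :: "'a \<Rightarrow> real" where f: "bounded_linear f" and "\<not> (\<lambda>n. f (u n)) \<longlonglongrightarrow> f l"
      by (auto simp: weakly_convergent_to_def)
    then obtain e where e: "e > 0" "\<exists>\<^sub>F n in sequentially. e \<le> dist (f (u n)) (f l)"
      by (auto simp: tendsto_iff frequently_def not_le)
    then have "infinite {n. e \<le> dist (f (u n)) (f l)}"
      by (simp add: frequently_cofinite flip: cofinite_eq_sequentially)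
    from infinite_enumerate[OF this] obtain r :: "nat \<Rightarrow> nat"
      where "strict_mono r \<and> (\<forall>n. r n \<in> {n. e \<le> dist (f (u n)) (f l)})" ..
    then have r: "strict_mono r" "\<And>n. e \<le> dist (f (u (r n))) (f l)" by auto
    have "bounded (range (\<lambda>n. u (r n)))" using bdd by (rule bounded_subset) auto
    then obtain q l' where q: "strict_mono q" "weakly_convergent_to (\<lambda>n. u (r (q n))) l'"
      by (rule bounded_weakly_convergent_subseq)
    have "l' = l"
      using unique[of "r \<circ> q" l'] q strict_mono_o[OF r(1) q(1)] by (simp add: o_def)
    then have "(\<lambda>n. f (u (r (q n)))) \<longlonglongrightarrow> f l"
      using weakly_convergent_toD[OF q(2) f] by simp
    from metric_LIMSEQ_D[OF this e(1)] r(2) show False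
      by (meson linorder_not_less order_refl)
  qed
  with lS show thesis by (rule that)
qed

section \<open>Averages\<close>

lemma cesaro_mean_tendsto:
  fixes a :: "nat \<Rightarrow> real"
  assumes a: "a \<longlonglongrightarrow> l"
  shows "(\<lambda>k. (1 / real k) * (\<Sum>i=1..k. a i)) \<longlonglongrightarrow> l"
proof (rule LIMSEQ_I)
  fix e :: real assume e: "e > 0"
  obtain N where N: "\<And>n. n \<ge> N \<Longrightarrow> norm (a n - l) < e / 2"
    using LIMSEQ_D[OF a, of "e / 2"] e by auto
  define C where "C = (\<Sum>i=1..N. \<bar>a i - l\<bar>)"
  have C0: "C \<ge> 0" by (simp add: C_def sum_nonneg)
  obtain N' where N': "real N' > 2 * C / e" using reals_Archimedean2 by blast
  have "norm ((1 / real k) * (\<Sum>i=1..k. a i) - l) < e" if k: "k \<ge> Suc (max N N')" for k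
  proof -
    have k0: "real k > 0" using k by simp
    have "(\<Sum>i=1..k. \<bar>a i - l\<bar>) \<le> (\<Sum>i=1..k. (if i \<le> N then \<bar>a i - l\<bar> else 0) + e / 2)"
      using N e by (intro sum_mono) (auto intro: less_imp_le)
    also have "\<dots> = (\<Sum>i=1..k. (if i \<le> N then \<bar>a i - l\<bar> else 0)) + k * (e / 2)"
      by (simp add: sum.distrib)
    also have "(\<Sum>i=1..k. (if i \<le> N then \<bar>a i - l\<bar> else 0)) = C"
      unfolding C_def using k by (intro sum.mono_neutral_cong_right) auto
    finally have 1: "(\<Sum>i=1..k. \<bar>a i - l\<bar>) \<le> C + k * (e / 2)" .
    have "2 * C / e < real k" using N' k by simp
    then have 2: "C < real k * (e / 2)" using e by (simp add: field_simps)
    have "(1 / real k) * (\<Sum>i=1..k. a i) - l = (1 / real k) * (\<Sum>i=1..k. a i - l)"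
      using k0 by (simp add: sum_subtractf field_simps)
    then have "norm ((1 / real k) * (\<Sum>i=1..k. a i) - l) \<le> (1 / real k) * (\<Sum>i=1..k. \<bar>a i - l\<bar>)"
      using k0 by (simp add: abs_mult divide_right_mono)
    also have "\<dots> < (1 / real k) * (real k * e)"
      using 1 2 k0 by (intro mult_strict_left_mono) auto
    also have "\<dots> = e" using k0 by simp
    finally show ?thesis .
  qed
  then show "\<exists>no. \<forall>k\<ge>no. norm ((1 / real k) * (\<Sum>i=1..k. a i) - l) < e" by blast
qed

lemma weakly_convergent_ergodic:
  assumes "weakly_convergent_to u l"
  shows "weakly_convergent_to (ergodic u) l"
  unfolding weakly_convergent_to_def
proof (intro allI impI)
  fix f :: "'a \<Rightarrow> real" assume f: "bounded_linear f"
  interpret bounded_linear f by fact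
  show "(\<lambda>k. f (ergodic u k)) \<longlonglongrightarrow> f l"
    using cesaro_mean_tendsto[OF weakly_convergent_toD[OF assms f]]
    by (simp add: ergodic_def scale sum)
qed

lemma ergodic_Pair: "ergodic (\<lambda>k. (u k, v k)) k = (ergodic u k, ergodic v k)"
  by (simp add: ergodic_def prod_eq_iff fst_sum snd_sum)



section \<open>Saddle points and the gap function\<close>

lemma ergodic_convex:
  fixes h :: "'c::real_vector \<Rightarrow> real"
  assumes "convex_on C h" "k \<ge> 1" "\<And>i. i \<ge> 1 \<Longrightarrow> w i \<in> C"
  shows "ergodic w k \<in> C" "h (ergodic w k) \<le> ergodic (\<lambda>i. h (w i)) k"
proof -
  have eq: "ergodic w k = (\<Sum>i=1..k. (1 / real k) *\<^sub>R w i)" for w :: "nat \<Rightarrow> 'd::real_vector"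
    by (simp add: ergodic_def scaleR_sum_right)
  show "ergodic w k \<in> C"
    unfolding eq by (rule convex_sum[OF _ convex_on_imp_convex[OF assms(1)]]) (use assms in auto)
  show "h (ergodic w k) \<le> ergodic (\<lambda>i. h (w i)) k"
    unfolding eq real_scaleR_def
    by (rule convex_on_sum[OF _ _ assms(1)]) (use assms in auto)
qed

text \<open>
  With \<open>gap u v u' v'\<close> for \<open>L(u, v') - L(u', v)\<close>, a pair is a saddle-point precisely when its gap
  to every other pair is at most \<open>0\<close>; both the gap estimate and convergence are then
  statements about this real-valued function.
\<close>

locale saddle_problem =
  fixes K :: "'a::{real_inner, complete_space} \<Rightarrow> 'b::{real_inner, complete_space}"
    and F :: "'a \<Rightarrow> ereal" and G :: "'b \<Rightarrow> ereal"
  assumes K: "bounded_linear K"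
    and F: "proper F" "convex_fun F" "lower_semicontinuous F"
    and G: "proper G" "convex_fun G" "lower_semicontinuous G"
begin

abbreviation f :: "'a \<Rightarrow> real" where "f u \<equiv> real_of_ereal (F u)"
abbreviation g :: "'b \<Rightarrow> real" where "g v \<equiv> real_of_ereal (G v)"

definition gap :: "'a \<Rightarrow> 'b \<Rightarrow> 'a \<Rightarrow> 'b \<Rightarrow> real" where
  "gap u v u' v' = (K u \<bullet> v' + f u - g v') - (K u' \<bullet> v + f u' - g v)"

sublocale K: bounded_linear K by (rule K)
sublocale adj: bounded_linear "adjoint K" by (rule bounded_linear_adjoint[OF K])

lemma adjoint_left: "adjoint K v \<bullet> u = K u \<bullet> v"
  by (metis adjoint_inner[OF K] inner_commute)

lemma adjoint_right: "u \<bullet> adjoint K v = K u \<bullet> v"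
  by (simp add: adjoint_inner[OF K])

lemma lagrangian_finite:
  assumes "u \<in> eff_dom F" "v \<in> eff_dom G"
  shows "lagrangian K F G u v = ereal (K u \<bullet> v + f u - g v)"
  using proper_finite[OF F(1) assms(1)] proper_finite[OF G(1) assms(2)]
  unfolding lagrangian_def by (metis ereal_minus(1) plus_ereal.simps(1))

lemma lagrangian_diff:
  assumes "u \<in> eff_dom F" "v \<in> eff_dom G" "u' \<in> eff_dom F" "v' \<in> eff_dom G"
  shows "lagrangian K F G u v' - lagrangian K F G u' v = ereal (gap u v u' v')"
  using assms by (simp add: lagrangian_finite gap_def)

lemma saddle_point_iff_gap:
  "saddle_point K F G s t \<longleftrightarrow> s \<in> eff_dom F \<and> t \<in> eff_dom G \<and>
     (\<forall>u\<in>eff_dom F. \<forall>v\<in>eff_dom G. gap s t u v \<le> 0)"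
proof (cases "s \<in> eff_dom F \<and> t \<in> eff_dom G")
  case True
  have "(\<forall>u\<in>eff_dom F. \<forall>v\<in>eff_dom G. K s \<bullet> v + f s - g v \<le> K s \<bullet> t + f s - g t \<and>
            K s \<bullet> t + f s - g t \<le> K u \<bullet> t + f u - g t)
      \<longleftrightarrow> (\<forall>u\<in>eff_dom F. \<forall>v\<in>eff_dom G. gap s t u v \<le> 0)"
    unfolding gap_def using True by (smt (verit))
  then show ?thesis using True by (simp add: saddle_point_def lagrangian_finite)
qed (auto simp: saddle_point_def)

lemma saddle_point_subgradients:
  assumes "saddle_point K F G s t"
  shows "- adjoint K t \<in> subdifferential F s" "K s \<in> subdifferential G t"
proof -
  have *: "s \<in> eff_dom F" "t \<in> eff_dom G"
    and gap: "\<And>u v. u \<in> eff_dom F \<Longrightarrow> v \<in> eff_dom G \<Longrightarrow> gap s t u v \<le> 0"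
    using assms by (auto simp: saddle_point_iff_gap)
  show "- adjoint K t \<in> subdifferential F s"
  proof (rule subgradientI[OF F(1) *(1)])
    fix u assume "u \<in> eff_dom F"
    from gap[OF this *(2)] show "f s + - adjoint K t \<bullet> (u - s) \<le> f u"
      by (simp add: gap_def adjoint_left K.diff inner_diff_left)
  qed
  show "K s \<in> subdifferential G t"
  proof (rule subgradientI[OF G(1) *(2)])
    fix v assume "v \<in> eff_dom G"
    from gap[OF *(1) this] show "g t + K s \<bullet> (v - t) \<le> g v"
      by (simp add: gap_def inner_diff_right)
  qed
qed

text \<open>
  The bilinear part of \<open>gap u v u' v'\<close> is weakly continuous in \<open>(u, v)\<close>, because
  \<open>u'\<close> and \<open>v'\<close> are fixed and no product of two weakly convergent sequences occurs. The rest is weakly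
  lower semicontinuous, so the gap is at most \<open>0\<close> in the limit. The limit inequality is first
  proved for real numbers below \<open>F s\<close> and \<open>G t\<close>, since the finiteness of these two values is itself
  one of its consequences.
\<close>

lemma weak_limit_saddle_point:
  assumes dom: "\<And>n. u n \<in> eff_dom F" "\<And>n. v n \<in> eff_dom G"
    and u: "weakly_convergent_to u s" and v: "weakly_convergent_to v t"
    and C: "\<And>u' v'. u' \<in> eff_dom F \<Longrightarrow> v' \<in> eff_dom G \<Longrightarrow>
      \<exists>c. c \<longlonglongrightarrow> 0 \<and> (\<forall>n. gap (u n) (v n) u' v' \<le> c n)"
  shows "saddle_point K F G s t"
proof -
  have sum_le: "a + b \<le> f u' + g v' - K s \<bullet> v' + K u' \<bullet> t"
    if "u' \<in> eff_dom F" "v' \<in> eff_dom G" and a: "ereal a < F s" and b: "ereal b < G t" for u' v' a b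
  proof -
    obtain c where c: "c \<longlonglongrightarrow> 0" "\<And>n. gap (u n) (v n) u' v' \<le> c n"
      using C \<open>u' \<in> eff_dom F\<close> \<open>v' \<in> eff_dom G\<close> by blast
    have lim: "(\<lambda>n. f u' + g v' - K (u n) \<bullet> v' + K u' \<bullet> v n + c n)
        \<longlonglongrightarrow> f u' + g v' - K s \<bullet> v' + K u' \<bullet> t + 0"
      by (intro tendsto_intros c weakly_convergent_toD[OF u] weakly_convergent_toD[OF v]
          bounded_linear_inner_right bounded_linear_compose[OF bounded_linear_inner_left K])
    have "eventually (\<lambda>n. a + b \<le> f u' + g v' - K (u n) \<bullet> v' + K u' \<bullet> v n + c n) sequentially"
      using weakly_lsc[OF F(2,3) u a] weakly_lsc[OF G(2,3) v b]
    proof eventually_elim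
      case (elim n)
      have "a < f (u n)" "b < g (v n)"
        using elim proper_finite[OF F(1) dom(1)[of n]] proper_finite[OF G(1) dom(2)[of n]]
        by (metis ereal_less(2) less_ereal.simps(1))+
      then show ?case using c(2)[of n] by (simp add: gap_def)
    qed
    from tendsto_lowerbound[OF lim this] show ?thesis by simp
  qed
  obtain u0 v0 where uv0: "u0 \<in> eff_dom F" "v0 \<in> eff_dom G"
    using F(1) G(1) by (auto simp: proper_def)
  have "- \<infinity> < F s" "- \<infinity> < G t" using F(1) G(1) by (auto simp: proper_def)
  then obtain a0 b0 where a0: "ereal a0 < F s" and b0: "ereal b0 < G t"
    by (metis ereal_dense2 ereal_less_ereal_Ex less_ereal.simps(2))
  have sD: "s \<in> eff_dom F"
  proof (rule in_eff_dom_if_le, rule ccontr)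
    let ?c = "f u0 + g v0 - K s \<bullet> v0 + K u0 \<bullet> t - b0"
    assume "\<not> F s \<le> ereal ?c"
    then obtain a where "ereal ?c < ereal a" "ereal a < F s"
      using ereal_dense2[of "ereal ?c" "F s"] by (auto simp: not_le)
    then show False using sum_le[OF uv0 _ b0, of a] by simp
  qed
  have tD: "t \<in> eff_dom G"
  proof (rule in_eff_dom_if_le, rule ccontr)
    let ?c = "f u0 + g v0 - K s \<bullet> v0 + K u0 \<bullet> t - a0"
    assume "\<not> G t \<le> ereal ?c"
    then obtain b where "ereal ?c < ereal b" "ereal b < G t"
      using ereal_dense2[of "ereal ?c" "G t"] by (auto simp: not_le)
    then show False using sum_le[OF uv0 a0, of b] by simp
  qed
  have "gap s t u' v' \<le> 0" if "u' \<in> eff_dom F" "v' \<in> eff_dom G" for u' v'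
  proof (rule field_le_epsilon)
    fix e :: real assume e: "e > 0"
    have "ereal (f s - e / 2) < F s"
      by (subst (2) proper_finite[OF F(1) sD]) (use e in simp)
    moreover have "ereal (g t - e / 2) < G t"
      by (subst (2) proper_finite[OF G(1) tD]) (use e in simp)
    ultimately show "gap s t u' v' \<le> 0 + e"
      using sum_le[OF that, of "f s - e / 2" "g t - e / 2"] by (simp add: gap_def)
  qed
  with sD tD show ?thesis by (simp add: saddle_point_iff_gap)
qed

lemma gap_ergodic:
  assumes k: "k \<ge> 1" and dom: "\<And>i. i \<ge> 1 \<Longrightarrow> u i \<in> eff_dom F" "\<And>i. i \<ge> 1 \<Longrightarrow> v i \<in> eff_dom G"
  shows "gap (ergodic u k) (ergodic v k) u' v' \<le> ergodic (\<lambda>i. gap (u i) (v i) u' v') k"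
proof -
  have eq: "ergodic (\<lambda>i. gap (u i) (v i) u' v') k =
      K (ergodic u k) \<bullet> v' - K u' \<bullet> ergodic v k + ergodic (\<lambda>i. f (u i)) k + ergodic (\<lambda>i. g (v i)) k
      - f u' - g v'"
    using k
    by (simp add: ergodic_def gap_def K.scale K.sum inner_sum_left inner_sum_right sum.distrib
        sum_subtractf field_simps)
  have "f (ergodic u k) \<le> ergodic (\<lambda>i. f (u i)) k"
    by (rule ergodic_convex(2)[OF convex_on_eff_dom[OF F(1,2)] k dom(1)])
  moreover have "g (ergodic v k) \<le> ergodic (\<lambda>i. g (v i)) k"
    by (rule ergodic_convex(2)[OF convex_on_eff_dom[OF G(1,2)] k dom(2)])
  ultimately show ?thesis unfolding eq unfolding gap_def by linarith
qed

end

section \<open>Null sequences and positive semidefinite operators\<close>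

lemma tendsto_inner_null_bounded:
  fixes u v :: "nat \<Rightarrow> 'a::real_inner"
  assumes "u \<longlonglongrightarrow> 0" "bounded (range v)"
  shows "(\<lambda>n. u n \<bullet> v n) \<longlonglongrightarrow> 0"
proof -
  obtain B where B: "\<And>n. norm (v n) \<le> B" using assms(2) by (auto simp: bounded_iff)
  have "(\<lambda>n. norm (u n) * B) \<longlonglongrightarrow> 0 * B"
    using assms(1) by (intro tendsto_mult tendsto_const tendsto_norm_zero)
  then have lim: "(\<lambda>n. norm (u n) * B) \<longlonglongrightarrow> 0" by simp
  have "norm (u n \<bullet> v n) \<le> norm (u n) * B" for n
    using Cauchy_Schwarz_ineq2[of "u n" "v n"] B[of n]
    by (metis mult_left_mono norm_ge_zero order_trans real_norm_def)
  then have "eventually (\<lambda>n. norm (u n \<bullet> v n) \<le> norm (u n) * B) sequentially"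
    by (rule always_eventually[OF allI])
  from Lim_null_comparison[OF this lim] show ?thesis .
qed

text \<open>
  Nonnegativity of the form of \<open>N\<close> at \<open>v - N v / C\<close>, where \<open>C\<close> bounds the norm of \<open>N\<close>. It turns
  convergence to \<open>0\<close> in the seminorm of \<open>N\<close> into convergence of \<open>N v\<close> in norm.
\<close>

lemma pos_semidef_norm_le:
  assumes N: "bounded_linear N" "self_adjoint N" "pos_semidef N"
  obtains C where "\<And>v. (norm (N v))\<^sup>2 \<le> C * (N v \<bullet> v)"
proof -
  interpret bounded_linear N by (rule N)
  obtain C where C: "C > 0" "\<And>v. norm (N v) \<le> norm v * C" using pos_bounded by blast
  have "(norm (N v))\<^sup>2 \<le> C * (N v \<bullet> v)" for v
  proof -
    let ?w = "v - (1 / C) *\<^sub>R N v"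
    have sa: "N (N v) \<bullet> v = N v \<bullet> N v" using N(2) by (simp add: self_adjoint_def)
    have "0 \<le> N ?w \<bullet> ?w" using N(3) by (simp add: pos_semidef_def)
    also have "\<dots> = N v \<bullet> v - 2 * (1 / C) * (norm (N v))\<^sup>2 + (1 / C)\<^sup>2 * (N (N v) \<bullet> N v)"
      using sa unfolding power2_norm_eq_inner
      by (simp add: diff scale inner_diff_left inner_diff_right power2_eq_square inner_commute)
    also have "N (N v) \<bullet> N v \<le> norm (N (N v)) * norm (N v)" by (rule norm_cauchy_schwarz)
    also have "\<dots> \<le> C * (norm (N v))\<^sup>2"
      using mult_right_mono[OF C(2)[of "N v"], of "norm (N v)"]
      by (simp add: power2_eq_square mult_ac)
    finally have "0 \<le> N v \<bullet> v - 2 * (1 / C) * (norm (N v))\<^sup>2 + (1 / C)\<^sup>2 * (C * (norm (N v))\<^sup>2)"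
      using C(1) by (simp add: mult_left_mono)
    then show ?thesis using C(1) by (simp add: field_simps power2_eq_square)
  qed
  then show thesis by (rule that)
qed

section \<open>One step of the iteration as an energy balance\<close>

locale preconditioned_douglas_rachford = saddle_problem K F G
  for K :: "'a::{real_inner, complete_space} \<Rightarrow> 'b::{real_inner, complete_space}"
    and F :: "'a \<Rightarrow> ereal" and G :: "'b \<Rightarrow> ereal" +
  fixes \<sigma> \<tau> :: real and M T :: "'a \<Rightarrow> 'a"
    and x b d xbar :: "nat \<Rightarrow> 'a" and y ybar :: "nat \<Rightarrow> 'b"
  assumes \<sigma>: "\<sigma> > 0" and \<tau>: "\<tau> > 0"
    and T: "T = (\<lambda>u. u + (\<sigma> * \<tau>) *\<^sub>R adjoint K (K u))"
    and M: "feasible_preconditioner M T"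
    and iter: "pDR_iteration K F G \<sigma> \<tau> M T x y b d xbar ybar"
begin

text \<open>
  The preconditioner enters the energies below through its error \<open>M - T\<close>, which contributes the seminorm
  for the component \<open>d\<close> of the state.
\<close>

definition N :: "'a \<Rightarrow> 'a" where "N u = M u - T u"

lemma N: "bounded_linear N" "self_adjoint N" "pos_semidef N"
proof -
  have *: "bounded_linear M" "bounded_linear T" "self_adjoint M" "self_adjoint T"
    "pos_semidef (\<lambda>u. M u - T u)"
    using M by (auto simp: feasible_preconditioner_def)
  have N: "N = (\<lambda>u. M u - T u)" by (rule ext) (simp add: N_def)
  show "bounded_linear N" unfolding N using * by (intro bounded_linear_sub)
  show "self_adjoint N" using * by (simp add: N self_adjoint_def inner_diff_left inner_diff_right)
  show "pos_semidef N" using * by (simp add: N)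
qed

sublocale N: bounded_linear N by (rule N)

lemma N_sym: "N u \<bullet> v = N v \<bullet> u"
  using N(2) by (simp add: self_adjoint_def inner_commute)

lemma N_nonneg: "0 \<le> N u \<bullet> u"
  using N(3) by (simp add: pos_semidef_def)

lemma xbar_Suc: "xbar (Suc k) = xbar k - x (Suc k) + d (Suc k)"
  and ybar_Suc: "ybar (Suc k) = y (Suc k) + \<tau> *\<^sub>R K (d (Suc k))"
  using iter by (simp_all add: pDR_iteration_def)

lemma x_subgradient: "(1 / \<sigma>) *\<^sub>R (xbar k - x (Suc k)) \<in> subdifferential F (x (Suc k))"
  using resolvent_subgradient[OF F \<sigma>, of "xbar k"] iter by (simp add: pDR_iteration_def)

lemma y_subgradient: "(1 / \<tau>) *\<^sub>R (ybar k - y (Suc k)) \<in> subdifferential G (y (Suc k))"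
  using resolvent_subgradient[OF G \<tau>, of "ybar k"] iter by (simp add: pDR_iteration_def)

lemma x_eff_dom: "x (Suc k) \<in> eff_dom F"
  by (rule subdifferential_eff_dom[OF F(1) x_subgradient])

lemma y_eff_dom: "y (Suc k) \<in> eff_dom G"
  by (rule subdifferential_eff_dom[OF G(1) y_subgradient])

text \<open>
  The preconditioned update says \<open>T d\<^sup>k\<^sup>+\<^sup>1 + N (d\<^sup>k\<^sup>+\<^sup>1 - d\<^sup>k) = b\<^sup>k\<^sup>+\<^sup>1\<close>. Inserting
  \<open>T = id + \<sigma> \<tau> K\<^sup>* K\<close> and replacing \<open>\<tau> K d\<^sup>k\<^sup>+\<^sup>1\<close> by \<open>ybar - y\<close> eliminates \<open>T\<close>.
\<close>

lemma linear_step: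
  "N (d k - d (Suc k)) = xbar (Suc k) - x (Suc k) + \<sigma> *\<^sub>R adjoint K (ybar (Suc k) + y (Suc k) - ybar k)"
proof -
  have "surj M" and linM: "bounded_linear M" and linT: "bounded_linear T"
    using M by (auto simp: feasible_preconditioner_def boundedly_invertible_def bij_is_surj)
  interpret M: bounded_linear M by (rule linM)
  interpret T: bounded_linear T by (rule linT)
  let ?b = "2 *\<^sub>R x (Suc k) - xbar k - \<sigma> *\<^sub>R adjoint K (2 *\<^sub>R y (Suc k) - ybar k)"
  have "d (Suc k) = d k + inv M (?b - T (d k))"
    using iter by (simp add: pDR_iteration_def)
  then have "M (d (Suc k)) = M (d k) + (?b - T (d k))"
    using surj_f_inv_f[OF \<open>surj M\<close>, of "?b - T (d k)"] by (simp add: M.add)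
  then have "N (d k - d (Suc k)) = T (d (Suc k)) - ?b"
    by (simp add: N_def M.diff T.diff)
  also have "T (d (Suc k)) = d (Suc k) + \<sigma> *\<^sub>R adjoint K (ybar (Suc k) - y (Suc k))"
    by (simp add: T ybar_Suc adj.scale)
  finally show ?thesis
    by (simp add: xbar_Suc adj.add adj.diff adj.scale algebra_simps scaleR_2)
qed

text \<open>
  The energy is half the squared distance, in a weighted seminorm, between the state
  \<open>(xbar, d, ybar)\<close> and the state that belongs to the pair \<open>(u, v)\<close>, namely
  \<open>(u - \<sigma> K\<^sup>* v, u, v + \<tau> K u)\<close>. The loss is the same seminorm of one increment of the state, and
  \<open>increment_bound\<close> is the inner product of that increment with the new distance vector. This is the
  three-term identity of proximal point iterations.
\<close>

definition energy :: "nat \<Rightarrow> 'a \<Rightarrow> 'b \<Rightarrow> real" where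
  "energy k u v = (norm (xbar k - u + \<sigma> *\<^sub>R adjoint K v))\<^sup>2 / (2 * \<sigma>)
     + (N (d k - u) \<bullet> (d k - u)) / (2 * \<sigma>) + (norm (ybar k - v - \<tau> *\<^sub>R K u))\<^sup>2 / (2 * \<tau>)"

definition energy_loss :: "nat \<Rightarrow> real" where
  "energy_loss k = (norm (xbar k - xbar (Suc k)))\<^sup>2 / (2 * \<sigma>)
     + (N (d k - d (Suc k)) \<bullet> (d k - d (Suc k))) / (2 * \<sigma>)
     + (norm (ybar k - ybar (Suc k)))\<^sup>2 / (2 * \<tau>)"

definition increment_bound :: "nat \<Rightarrow> 'a \<Rightarrow> 'b \<Rightarrow> real" where
  "increment_bound k u v =
     ((xbar k - xbar (Suc k)) \<bullet> (xbar (Suc k) - u + \<sigma> *\<^sub>R adjoint K v)) / \<sigma>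
     + (N (d k - d (Suc k)) \<bullet> (d (Suc k) - u)) / \<sigma>
     + ((ybar k - ybar (Suc k)) \<bullet> (ybar (Suc k) - v - \<tau> *\<^sub>R K u)) / \<tau>"

lemma energy_nonneg: "0 \<le> energy k u v"
  using \<sigma> \<tau> N_nonneg by (simp add: energy_def)

lemma energy_loss_nonneg: "0 \<le> energy_loss k"
  using \<sigma> \<tau> N_nonneg by (simp add: energy_loss_def)

lemma energy_diff: "energy k u v - energy (Suc k) u v = energy_loss k + increment_bound k u v"
proof -
  have pol: "(norm p)\<^sup>2 - (norm q)\<^sup>2 = (norm (p - q))\<^sup>2 + 2 * ((p - q) \<bullet> q)" for p q :: "'c::real_inner"
    by (simp add: power2_norm_eq_inner inner_diff_left inner_diff_right inner_commute)
  have polN: "N p \<bullet> p - N q \<bullet> q = N (p - q) \<bullet> (p - q) + 2 * (N (p - q) \<bullet> q)" for p q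
    by (simp add: N.diff inner_diff_left inner_diff_right N_sym[of q p])
  have 1: "(norm (xbar k - u + \<sigma> *\<^sub>R adjoint K v))\<^sup>2 - (norm (xbar (Suc k) - u + \<sigma> *\<^sub>R adjoint K v))\<^sup>2
      = (norm (xbar k - xbar (Suc k)))\<^sup>2
        + 2 * ((xbar k - xbar (Suc k)) \<bullet> (xbar (Suc k) - u + \<sigma> *\<^sub>R adjoint K v))"
    using pol[of "xbar k - u + \<sigma> *\<^sub>R adjoint K v" "xbar (Suc k) - u + \<sigma> *\<^sub>R adjoint K v"] by simp
  have 2: "N (d k - u) \<bullet> (d k - u) - N (d (Suc k) - u) \<bullet> (d (Suc k) - u)
      = N (d k - d (Suc k)) \<bullet> (d k - d (Suc k)) + 2 * (N (d k - d (Suc k)) \<bullet> (d (Suc k) - u))"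
    using polN[of "d k - u" "d (Suc k) - u"] by simp
  have 3: "(norm (ybar k - v - \<tau> *\<^sub>R K u))\<^sup>2 - (norm (ybar (Suc k) - v - \<tau> *\<^sub>R K u))\<^sup>2
      = (norm (ybar k - ybar (Suc k)))\<^sup>2
        + 2 * ((ybar k - ybar (Suc k)) \<bullet> (ybar (Suc k) - v - \<tau> *\<^sub>R K u))"
    using pol[of "ybar k - v - \<tau> *\<^sub>R K u" "ybar (Suc k) - v - \<tau> *\<^sub>R K u"] by simp
  have "energy k u v - energy (Suc k) u v =
      ((norm (xbar k - u + \<sigma> *\<^sub>R adjoint K v))\<^sup>2 - (norm (xbar (Suc k) - u + \<sigma> *\<^sub>R adjoint K v))\<^sup>2) / (2 * \<sigma>)
      + (N (d k - u) \<bullet> (d k - u) - N (d (Suc k) - u) \<bullet> (d (Suc k) - u)) / (2 * \<sigma>)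
      + ((norm (ybar k - v - \<tau> *\<^sub>R K u))\<^sup>2 - (norm (ybar (Suc k) - v - \<tau> *\<^sub>R K u))\<^sup>2) / (2 * \<tau>)"
    by (simp add: energy_def diff_divide_distrib)
  also have "\<dots> = energy_loss k + increment_bound k u v"
    unfolding 1 2 3 energy_loss_def increment_bound_def by (simp add: add_divide_distrib)
  finally show ?thesis .
qed

text \<open>
  Substituting the update rules, everything quadratic in the auxiliary variables \<open>xbar\<close>, \<open>d\<close> and
  \<open>ybar\<close> cancels, and exactly the terms remain that the two subgradient inequalities provide.
\<close>

lemma increment_bound_eq:
  "increment_bound k u v = K (x (Suc k)) \<bullet> v - K u \<bullet> y (Suc k)
     + ((xbar k - x (Suc k)) \<bullet> (x (Suc k) - u)) / \<sigma> + ((ybar k - y (Suc k)) \<bullet> (y (Suc k) - v)) / \<tau>"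
proof -
  define a p e c q where "a = xbar (Suc k)" and "p = x (Suc k)" and "e = d (Suc k)"
    and "c = ybar k" and "q = y (Suc k)"
  have xb: "xbar k = a + p - e" by (simp add: a_def p_def e_def xbar_Suc)
  have yb: "ybar (Suc k) = q + \<tau> *\<^sub>R K e" by (simp add: q_def e_def ybar_Suc)
  have Nd: "N (d k - e) = a - p + \<sigma> *\<^sub>R adjoint K (2 *\<^sub>R q + \<tau> *\<^sub>R K e - c)"
    using linear_step[of k] unfolding yb by (simp add: a_def p_def e_def q_def c_def scaleR_2 algebra_simps)
  have 1: "(p - e) \<bullet> (a - u) + (a - p) \<bullet> (e - u) = (a - e) \<bullet> (p - u)"
    by (simp add: inner_diff_left inner_diff_right inner_commute)
  have 2: "K (p - e) \<bullet> v + K (e - u) \<bullet> (2 *\<^sub>R q + \<tau> *\<^sub>R K e - c)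
      + ((c - q - \<tau> *\<^sub>R K e) \<bullet> (q + \<tau> *\<^sub>R K e - v - \<tau> *\<^sub>R K u)) / \<tau>
      = K p \<bullet> v - K u \<bullet> q + ((c - q) \<bullet> (q - v)) / \<tau>"
    using \<tau> by (simp add: K.diff inner_diff_left inner_diff_right inner_add_left inner_add_right
        inner_commute field_simps)
  have "increment_bound k u v =
      ((p - e) \<bullet> (a - u) + (a - p) \<bullet> (e - u)) / \<sigma>
      + (K (p - e) \<bullet> v + K (e - u) \<bullet> (2 *\<^sub>R q + \<tau> *\<^sub>R K e - c)
        + ((c - q - \<tau> *\<^sub>R K e) \<bullet> (q + \<tau> *\<^sub>R K e - v - \<tau> *\<^sub>R K u)) / \<tau>)"
    unfolding increment_bound_def e_def[symmetric] Nd xb yb a_def[symmetric] c_def[symmetric]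
    using \<sigma> by (simp add: inner_add_left[of "a - p"] inner_add_right[of _ "a - u"] adjoint_left adjoint_right
        add_divide_distrib diff_diff_eq)
  also have "\<dots> = ((a - e) \<bullet> (p - u)) / \<sigma> + (K p \<bullet> v - K u \<bullet> q + ((c - q) \<bullet> (q - v)) / \<tau>)"
    unfolding 1 2 ..
  also have "a - e = xbar k - p" by (simp add: xb)
  finally show ?thesis by (simp add: p_def q_def c_def)
qed

lemma gap_le_increment_bound:
  assumes "u \<in> eff_dom F" "v \<in> eff_dom G"
  shows "gap (x (Suc k)) (y (Suc k)) u v \<le> increment_bound k u v"
proof -
  have "f (x (Suc k)) - f u \<le> ((xbar k - x (Suc k)) \<bullet> (x (Suc k) - u)) / \<sigma>"
    using subgradient_ineq[OF F(1) x_subgradient[of k] assms(1)] by (simp add: inner_diff_right diff_divide_distrib)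
  moreover have "g (y (Suc k)) - g v \<le> ((ybar k - y (Suc k)) \<bullet> (y (Suc k) - v)) / \<tau>"
    using subgradient_ineq[OF G(1) y_subgradient[of k] assms(2)] by (simp add: inner_diff_right diff_divide_distrib)
  ultimately show ?thesis unfolding increment_bound_eq gap_def by simp
qed

text \<open>
  Being a difference of consecutive energies, the right-hand side telescopes when the inequalities
  are averaged.
\<close>

lemma gap_le_energy_diff:
  assumes "u \<in> eff_dom F" "v \<in> eff_dom G"
  shows "gap (x (Suc k)) (y (Suc k)) u v \<le> energy k u v - energy (Suc k) u v"
  using gap_le_increment_bound[OF assms, of k] energy_diff[of k u v] energy_loss_nonneg[of k] by linarith

lemma ergodic_gap_le:
  assumes "u \<in> eff_dom F" "v \<in> eff_dom G" "k \<ge> 1"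
  shows "gap (ergodic x k) (ergodic y k) u v \<le> (1 / real k) * energy 0 u v"
proof -
  have dom: "x i \<in> eff_dom F" "y i \<in> eff_dom G" if "i \<ge> 1" for i
    using that x_eff_dom[of "i - 1"] y_eff_dom[of "i - 1"] by simp_all
  have "(\<Sum>i=1..k. gap (x i) (y i) u v) = (\<Sum>i<k. gap (x (Suc i)) (y (Suc i)) u v)"
    by (simp add: sum.atLeast1_atMost_eq)
  also have "\<dots> \<le> (\<Sum>i<k. energy i u v - energy (Suc i) u v)"
    by (intro sum_mono gap_le_energy_diff assms)
  also have "\<dots> = energy 0 u v - energy k u v" by (rule sum_lessThan_telescope')
  also have "\<dots> \<le> energy 0 u v" using energy_nonneg by simp
  finally have "ergodic (\<lambda>i. gap (x i) (y i) u v) k \<le> (1 / real k) * energy 0 u v"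
    unfolding ergodic_def by (simp add: divide_right_mono)
  moreover have "gap (ergodic x k) (ergodic y k) u v \<le> ergodic (\<lambda>i. gap (x i) (y i) u v) k"
    by (rule gap_ergodic[OF assms(3) dom])
  ultimately show ?thesis by simp
qed

lemma restricted_gap_ergodic_le:
  assumes X0: "X0 \<subseteq> eff_dom F" and Y0: "Y0 \<subseteq> eff_dom G" and k: "k \<ge> 1"
  shows "restricted_gap K F G X0 Y0 (ergodic x k) (ergodic y k)
    \<le> ereal (1 / real k) * (SUP (u, v) \<in> X0 \<times> Y0. ereal (energy 0 u v))"
  unfolding restricted_gap_def
proof (rule SUP_least, clarify)
  fix u v assume uv: "u \<in> X0" "v \<in> Y0"
  then have dom: "u \<in> eff_dom F" "v \<in> eff_dom G" using X0 Y0 by auto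
  have erg: "ergodic x k \<in> eff_dom F" "ergodic y k \<in> eff_dom G"
    using ergodic_convex(1)[OF convex_on_eff_dom[OF F(1,2)] k, of x] x_eff_dom
      ergodic_convex(1)[OF convex_on_eff_dom[OF G(1,2)] k, of y] y_eff_dom
    by (metis Suc_le_D One_nat_def)+
  have "lagrangian K F G (ergodic x k) v - lagrangian K F G u (ergodic y k)
      = ereal (gap (ergodic x k) (ergodic y k) u v)"
    by (rule lagrangian_diff[OF erg dom])
  also have "\<dots> \<le> ereal (1 / real k) * ereal (energy 0 u v)"
    using ergodic_gap_le[OF dom k] by simp
  also have "\<dots> \<le> ereal (1 / real k) * (SUP (u, v) \<in> X0 \<times> Y0. ereal (energy 0 u v))"
    using uv by (intro ereal_mult_left_mono SUP_upper2[of "(u, v)"]) auto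
  finally show "lagrangian K F G (ergodic x k) v - lagrangian K F G u (ergodic y k)
      \<le> ereal (1 / real k) * (SUP (u, v) \<in> X0 \<times> Y0. ereal (energy 0 u v))" .
qed

section \<open>Separating saddle points by the energy\<close>

text \<open>
  The difference of the energies relative to two fixed pairs is affine in the state, since the terms
  quadratic in the state cancel.
\<close>

lemma energy_const_diff:
  "energy k s t - energy k s' t' =
     (xbar k \<bullet> ((s' - s) - \<sigma> *\<^sub>R adjoint K (t' - t))) / \<sigma> + (N (d k) \<bullet> (s' - s)) / \<sigma>
     + (ybar k \<bullet> ((t' - t) + \<tau> *\<^sub>R K (s' - s))) / \<tau>
     + ((norm (s - \<sigma> *\<^sub>R adjoint K t))\<^sup>2 - (norm (s' - \<sigma> *\<^sub>R adjoint K t'))\<^sup>2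
        + N s \<bullet> s - N s' \<bullet> s') / (2 * \<sigma>)
     + ((norm (t + \<tau> *\<^sub>R K s))\<^sup>2 - (norm (t' + \<tau> *\<^sub>R K s'))\<^sup>2) / (2 * \<tau>)"
proof -
  have pol: "(norm (w - p))\<^sup>2 - (norm (w - p'))\<^sup>2 = 2 * (w \<bullet> (p' - p)) + (norm p)\<^sup>2 - (norm p')\<^sup>2"
    for w p p' :: "'c::real_inner"
    unfolding power2_norm_eq_inner by (simp add: inner_diff_left inner_diff_right inner_commute)
  have polN: "N (w - p) \<bullet> (w - p) - N (w - p') \<bullet> (w - p') = 2 * (N w \<bullet> (p' - p)) + N p \<bullet> p - N p' \<bullet> p'"
    for w p p'
    by (simp add: N.diff inner_diff_left inner_diff_right N_sym[of p w] N_sym[of p' w])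
  have X: "xbar k - u + \<sigma> *\<^sub>R adjoint K v = xbar k - (u - \<sigma> *\<^sub>R adjoint K v)" for u v by simp
  have Y: "ybar k - v - \<tau> *\<^sub>R K u = ybar k - (v + \<tau> *\<^sub>R K u)" for u v by simp
  have "energy k s t - energy k s' t' =
      ((norm (xbar k - (s - \<sigma> *\<^sub>R adjoint K t)))\<^sup>2 - (norm (xbar k - (s' - \<sigma> *\<^sub>R adjoint K t')))\<^sup>2) / (2 * \<sigma>)
      + (N (d k - s) \<bullet> (d k - s) - N (d k - s') \<bullet> (d k - s')) / (2 * \<sigma>)
      + ((norm (ybar k - (t + \<tau> *\<^sub>R K s)))\<^sup>2 - (norm (ybar k - (t' + \<tau> *\<^sub>R K s')))\<^sup>2) / (2 * \<tau>)"
    unfolding energy_def X Y by (simp add: diff_divide_distrib)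
  moreover have "s' - \<sigma> *\<^sub>R adjoint K t' - (s - \<sigma> *\<^sub>R adjoint K t) = (s' - s) - \<sigma> *\<^sub>R adjoint K (t' - t)"
    by (simp add: adj.diff algebra_simps)
  moreover have "t' + \<tau> *\<^sub>R K s' - (t + \<tau> *\<^sub>R K s) = (t' - t) + \<tau> *\<^sub>R K (s' - s)"
    by (simp add: K.diff algebra_simps)
  ultimately show ?thesis
    unfolding pol polN by (simp add: add_divide_distrib diff_divide_distrib)
qed

text \<open>
  The linear part of the preceding difference, for \<open>p = s' - s\<close> and \<open>q = t' - t\<close>, at the state that belongs to the pair \<open>z\<close>
  instead of the actual state. At \<open>z = (p, q)\<close> it is a sum of three squares whose vanishing forces
  \<open>p = \<sigma> K\<^sup>* q\<close> and \<open>q = - \<tau> K p\<close>, hence \<open>\<parallel>p\<parallel>\<^sup>2 = - \<sigma> \<tau> \<parallel>K p\<parallel>\<^sup>2\<close>.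
\<close>

definition separator :: "'a \<Rightarrow> 'b \<Rightarrow> 'a \<times> 'b \<Rightarrow> real" where
  "separator p q z = ((fst z - \<sigma> *\<^sub>R adjoint K (snd z)) \<bullet> (p - \<sigma> *\<^sub>R adjoint K q)) / \<sigma>
     + (N (fst z) \<bullet> p) / \<sigma> + ((snd z + \<tau> *\<^sub>R K (fst z)) \<bullet> (q + \<tau> *\<^sub>R K p)) / \<tau>"

lemma separator_bounded_linear: "bounded_linear (separator p q)"
proof -
  note comp = bounded_linear_compose[OF K] bounded_linear_compose[OF N(1)]
    bounded_linear_compose[OF bounded_linear_adjoint[OF K]]
  have "bounded_linear (\<lambda>z. ((fst z - \<sigma> *\<^sub>R adjoint K (snd z)) \<bullet> (p - \<sigma> *\<^sub>R adjoint K q)) / \<sigma>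
     + (N (fst z) \<bullet> p) / \<sigma> + ((snd z + \<tau> *\<^sub>R K (fst z)) \<bullet> (q + \<tau> *\<^sub>R K p)) / \<tau>)"
    by (intro bounded_linear_add bounded_linear_sub bounded_linear_fst bounded_linear_snd comp
        bounded_linear_compose[OF bounded_linear_divide]
        bounded_linear_compose[OF bounded_linear_inner_left]
        bounded_linear_compose[OF bounded_linear_scaleR_right])
  then show ?thesis by (simp add: separator_def[abs_def])
qed

lemma separator_diag_nonzero:
  assumes "(p, q) \<noteq> (0, 0)"
  shows "separator p q (p, q) \<noteq> 0"
proof
  assume "separator p q (p, q) = 0"
  then have sum0: "(norm (p - \<sigma> *\<^sub>R adjoint K q))\<^sup>2 / \<sigma> + (N p \<bullet> p) / \<sigma> + (norm (q + \<tau> *\<^sub>R K p))\<^sup>2 / \<tau> = 0"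
    by (simp add: separator_def power2_norm_eq_inner)
  have "0 \<le> (norm (p - \<sigma> *\<^sub>R adjoint K q))\<^sup>2 / \<sigma>" "0 \<le> (N p \<bullet> p) / \<sigma>" "0 \<le> (norm (q + \<tau> *\<^sub>R K p))\<^sup>2 / \<tau>"
    using \<sigma> \<tau> N_nonneg by simp_all
  with sum0 have "(norm (p - \<sigma> *\<^sub>R adjoint K q))\<^sup>2 / \<sigma> = 0" "(norm (q + \<tau> *\<^sub>R K p))\<^sup>2 / \<tau> = 0"
    by linarith+
  then have pq: "p = \<sigma> *\<^sub>R adjoint K q" "q = - (\<tau> *\<^sub>R K p)"
    using \<sigma> \<tau> by (simp_all add: eq_neg_iff_add_eq_0)
  have "p \<bullet> p = p \<bullet> (\<sigma> *\<^sub>R adjoint K q)" using pq(1) by simp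
  also have "\<dots> = \<sigma> * (K p \<bullet> q)" by (simp add: adjoint_right)
  also have "\<dots> = - (\<sigma> * \<tau> * (K p \<bullet> K p))" by (subst pq(2)) simp
  also have "\<dots> \<le> 0" using \<sigma> \<tau> by simp
  finally have "p = 0" by (metis inner_gt_zero_iff not_le)
  moreover then have "q = 0" using pq(2) by (simp add: K.zero)
  ultimately show False using assms by simp
qed

section \<open>Weak convergence of the iterates\<close>

text \<open>
  At a saddle-point the gap of the iterates is nonnegative, so the energy decreases at least by the loss.
\<close>

lemma energy_step:
  assumes "saddle_point K F G s t"
  shows "energy (Suc k) s t + energy_loss k \<le> energy k s t"
proof -
  have st: "s \<in> eff_dom F" "t \<in> eff_dom G" "gap s t (x (Suc k)) (y (Suc k)) \<le> 0"
    using assms x_eff_dom y_eff_dom by (auto simp: saddle_point_iff_gap)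
  then have "0 \<le> gap (x (Suc k)) (y (Suc k)) s t" by (simp add: gap_def)
  with gap_le_increment_bound[OF st(1,2), of k] energy_diff[of k s t] show ?thesis by linarith
qed

lemma energy_decseq:
  assumes "saddle_point K F G s t"
  shows "decseq (\<lambda>k. energy k s t)"
proof (rule decseq_SucI)
  fix k show "energy (Suc k) s t \<le> energy k s t"
    using energy_step[OF assms, of k] energy_loss_nonneg[of k] by linarith
qed

lemma energy_convergent:
  assumes "saddle_point K F G s t"
  shows "convergent (\<lambda>k. energy k s t)"
  using decseq_convergent[OF energy_decseq[OF assms], of 0] energy_nonneg convergentI by metis

text \<open>
  One saddle-point suffices to control the iteration: its energy converges, so the losses tend to \<open>0\<close>,
  and it bounds all sequences.
\<close>

context
  fixes s0 :: 'a and t0 :: 'b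
  assumes saddle: "saddle_point K F G s0 t0"
begin

lemma energy_loss_tendsto: "energy_loss \<longlonglongrightarrow> 0"
proof -
  obtain L where L: "(\<lambda>k. energy k s0 t0) \<longlonglongrightarrow> L"
    using energy_convergent[OF saddle] by (auto simp: convergent_def)
  have "(\<lambda>k. energy k s0 t0 - energy (Suc k) s0 t0) \<longlonglongrightarrow> L - L"
    by (intro tendsto_diff L LIMSEQ_Suc)
  then have lim: "(\<lambda>k. energy k s0 t0 - energy (Suc k) s0 t0) \<longlonglongrightarrow> 0" by simp
  show ?thesis
  proof (rule tendsto_sandwich[OF _ _ tendsto_const lim])
    show "\<forall>\<^sub>F k in sequentially. 0 \<le> energy_loss k" using energy_loss_nonneg by simp
    show "\<forall>\<^sub>F k in sequentially. energy_loss k \<le> energy k s0 t0 - energy (Suc k) s0 t0"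
      using energy_step[OF saddle] by (simp add: le_diff_eq add.commute)
  qed
qed

lemma tendsto_zero_of_norm_sq:
  fixes w :: "nat \<Rightarrow> 'c::real_normed_vector"
  assumes "\<And>k. (norm (w k))\<^sup>2 \<le> C * energy_loss k"
  shows "w \<longlonglongrightarrow> 0"
proof -
  have "(\<lambda>k. C * energy_loss k) \<longlonglongrightarrow> C * 0"
    by (intro tendsto_mult tendsto_const energy_loss_tendsto)
  then have lim: "(\<lambda>k. C * energy_loss k) \<longlonglongrightarrow> 0" by simp
  have "(\<lambda>k. (norm (w k))\<^sup>2) \<longlonglongrightarrow> 0"
    by (rule tendsto_sandwich[OF _ _ tendsto_const lim]) (use assms in auto)
  then have "(\<lambda>k. sqrt ((norm (w k))\<^sup>2)) \<longlonglongrightarrow> sqrt 0" by (rule tendsto_real_sqrt)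
  then show ?thesis by (simp add: tendsto_norm_zero_iff)
qed

lemma xbar_diff_tendsto: "(\<lambda>k. xbar k - xbar (Suc k)) \<longlonglongrightarrow> 0"
  and ybar_diff_tendsto: "(\<lambda>k. ybar k - ybar (Suc k)) \<longlonglongrightarrow> 0"
  and N_d_diff_tendsto: "(\<lambda>k. N (d k - d (Suc k))) \<longlonglongrightarrow> 0"
proof -
  have parts: "0 \<le> (norm (xbar k - xbar (Suc k)))\<^sup>2 / (2 * \<sigma>)"
    "0 \<le> (N (d k - d (Suc k)) \<bullet> (d k - d (Suc k))) / (2 * \<sigma>)"
    "0 \<le> (norm (ybar k - ybar (Suc k)))\<^sup>2 / (2 * \<tau>)" for k
    using \<sigma> \<tau> N_nonneg by simp_all
  have "(norm (xbar k - xbar (Suc k)))\<^sup>2 / (2 * \<sigma>) \<le> energy_loss k" for k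
    using parts[of k] unfolding energy_loss_def by linarith
  then show "(\<lambda>k. xbar k - xbar (Suc k)) \<longlonglongrightarrow> 0"
    by (intro tendsto_zero_of_norm_sq[where C = "2 * \<sigma>"]) (use \<sigma> in \<open>simp add: field_simps\<close>)
  have "(norm (ybar k - ybar (Suc k)))\<^sup>2 / (2 * \<tau>) \<le> energy_loss k" for k
    using parts[of k] unfolding energy_loss_def by linarith
  then show "(\<lambda>k. ybar k - ybar (Suc k)) \<longlonglongrightarrow> 0"
    by (intro tendsto_zero_of_norm_sq[where C = "2 * \<tau>"]) (use \<tau> in \<open>simp add: field_simps\<close>)
  obtain C where C: "\<And>v. (norm (N v))\<^sup>2 \<le> C * (N v \<bullet> v)"
    using pos_semidef_norm_le[OF N] by blast
  have "(N (d k - d (Suc k)) \<bullet> (d k - d (Suc k))) / (2 * \<sigma>) \<le> energy_loss k" for k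
    using parts[of k] unfolding energy_loss_def by linarith
  then have "N (d k - d (Suc k)) \<bullet> (d k - d (Suc k)) \<le> 2 * \<sigma> * energy_loss k" for k
    using \<sigma> by (simp add: field_simps)
  then have "\<bar>C\<bar> * (N (d k - d (Suc k)) \<bullet> (d k - d (Suc k))) \<le> \<bar>C\<bar> * (2 * \<sigma> * energy_loss k)" for k
    by (intro mult_left_mono) auto
  moreover have "C * (N v \<bullet> v) \<le> \<bar>C\<bar> * (N v \<bullet> v)" for v
    using N_nonneg by (intro mult_right_mono) auto
  ultimately have "(norm (N (d k - d (Suc k))))\<^sup>2 \<le> \<bar>C\<bar> * (2 * \<sigma>) * energy_loss k" for k
    using C by (metis (no_types, opaque_lifting) mult.assoc order_trans)
  then show "(\<lambda>k. N (d k - d (Suc k))) \<longlonglongrightarrow> 0"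
    by (rule tendsto_zero_of_norm_sq)
qed

lemma d_minus_x_tendsto: "(\<lambda>k. d (Suc k) - x (Suc k)) \<longlonglongrightarrow> 0"
proof -
  have "d (Suc k) - x (Suc k) = - (xbar k - xbar (Suc k))" for k
    by (simp add: xbar_Suc)
  then show ?thesis using tendsto_minus[OF xbar_diff_tendsto] by simp
qed

text \<open>
  This lemma, the next one and \<open>d_minus_x_tendsto\<close> say that the actual state approaches, in norm, the state belonging to
  the current iterate \<open>(x, y)\<close>.
\<close>

lemma ybar_asymptotic: "(\<lambda>k. ybar (Suc k) - (y (Suc k) + \<tau> *\<^sub>R K (x (Suc k)))) \<longlonglongrightarrow> 0"
proof -
  have "ybar (Suc k) - (y (Suc k) + \<tau> *\<^sub>R K (x (Suc k))) = \<tau> *\<^sub>R K (d (Suc k) - x (Suc k))" for k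
    by (simp add: ybar_Suc K.diff algebra_simps)
  moreover have "(\<lambda>k. \<tau> *\<^sub>R K (d (Suc k) - x (Suc k))) \<longlonglongrightarrow> \<tau> *\<^sub>R 0"
    by (intro tendsto_scaleR tendsto_const K.tendsto_zero d_minus_x_tendsto)
  ultimately show ?thesis by simp
qed

lemma xbar_asymptotic: "(\<lambda>k. xbar (Suc k) - (x (Suc k) - \<sigma> *\<^sub>R adjoint K (y (Suc k)))) \<longlonglongrightarrow> 0"
proof -
  have "xbar (Suc k) - (x (Suc k) - \<sigma> *\<^sub>R adjoint K (y (Suc k)))
      = N (d k - d (Suc k)) + \<sigma> *\<^sub>R adjoint K (ybar k - ybar (Suc k))" for k
    unfolding linear_step by (simp add: adj.add adj.diff algebra_simps)
  moreover have "(\<lambda>k. N (d k - d (Suc k)) + \<sigma> *\<^sub>R adjoint K (ybar k - ybar (Suc k))) \<longlonglongrightarrow> 0 + \<sigma> *\<^sub>R 0"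
    by (intro tendsto_add tendsto_scaleR tendsto_const adj.tendsto_zero N_d_diff_tendsto ybar_diff_tendsto)
  ultimately show ?thesis by simp
qed

text \<open>
  The energy bounds \<open>xbar\<close> and \<open>ybar\<close>; \<open>x\<close> and \<open>y\<close> inherit the bounds because resolvents are
  nonexpansive, and \<open>d\<close> because it stays close to \<open>x\<close>. The energy itself gives no bound
  on \<open>d\<close>, as the seminorm of \<open>N\<close> may degenerate.
\<close>

lemma bounded_iterates:
  "bounded (range xbar)" "bounded (range ybar)" "bounded (range (\<lambda>k. x (Suc k)))"
  "bounded (range (\<lambda>k. y (Suc k)))" "bounded (range (\<lambda>k. d (Suc k)))"
proof -
  let ?E = "energy 0 s0 t0"
  have E: "energy k s0 t0 \<le> ?E" for k
    using energy_decseq[OF saddle] by (simp add: decseq_def)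
  have parts: "0 \<le> (norm (xbar k - s0 + \<sigma> *\<^sub>R adjoint K t0))\<^sup>2 / (2 * \<sigma>)"
    "0 \<le> (N (d k - s0) \<bullet> (d k - s0)) / (2 * \<sigma>)"
    "0 \<le> (norm (ybar k - t0 - \<tau> *\<^sub>R K s0))\<^sup>2 / (2 * \<tau>)" for k
    using \<sigma> \<tau> N_nonneg by simp_all
  have "(norm (xbar k - s0 + \<sigma> *\<^sub>R adjoint K t0))\<^sup>2 / (2 * \<sigma>) \<le> ?E" for k
    using parts[of k] E[of k] unfolding energy_def by linarith
  then have "(norm (xbar k - (s0 - \<sigma> *\<^sub>R adjoint K t0)))\<^sup>2 \<le> 2 * \<sigma> * ?E" for k
    using \<sigma> by (simp add: field_simps)
  then have xb: "norm (xbar k - (s0 - \<sigma> *\<^sub>R adjoint K t0)) \<le> sqrt (2 * \<sigma> * ?E)" for k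
    by (rule real_le_rsqrt)
  have "(norm (ybar k - t0 - \<tau> *\<^sub>R K s0))\<^sup>2 / (2 * \<tau>) \<le> ?E" for k
    using parts[of k] E[of k] unfolding energy_def by linarith
  then have "(norm (ybar k - (t0 + \<tau> *\<^sub>R K s0)))\<^sup>2 \<le> 2 * \<tau> * ?E" for k
    using \<tau> by (simp add: field_simps)
  then have yb: "norm (ybar k - (t0 + \<tau> *\<^sub>R K s0)) \<le> sqrt (2 * \<tau> * ?E)" for k
    by (rule real_le_rsqrt)
  have bound: "bounded (range w)" if "\<And>k. norm (w k - c) \<le> B" for w :: "nat \<Rightarrow> 'c::real_normed_vector" and c B
    using that by (auto simp: bounded_def dist_norm norm_minus_commute)
  show bxb: "bounded (range xbar)" by (rule bound[OF xb])
  show "bounded (range ybar)" by (rule bound[OF yb])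
  have "norm (x (Suc k) - s0) \<le> norm (xbar k - (s0 - \<sigma> *\<^sub>R adjoint K t0))" for k
    using subdifferential_nonexpansive[OF F(1) x_subgradient saddle_point_subgradients(1)[OF saddle] \<sigma>, of k]
      \<sigma> by simp
  then show bx: "bounded (range (\<lambda>k. x (Suc k)))" using xb by (intro bound) (rule order_trans)
  have "norm (y (Suc k) - t0) \<le> norm (ybar k - (t0 + \<tau> *\<^sub>R K s0))" for k
    using subdifferential_nonexpansive[OF G(1) y_subgradient saddle_point_subgradients(2)[OF saddle] \<tau>, of k]
      \<tau> by simp
  then show "bounded (range (\<lambda>k. y (Suc k)))" using yb by (intro bound) (rule order_trans)
  have "bounded (range (\<lambda>k. d (Suc k) - x (Suc k)))"
    by (intro convergent_imp_bounded[OF d_minus_x_tendsto])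
  from bounded_plus_comp[OF this bx] show "bounded (range (\<lambda>k. d (Suc k)))" by simp
qed

text \<open>
  Each term pairs a null sequence with a bounded one. Since the gap of the iterates relative to any
  pair is at most this bound, every weak cluster point is a saddle-point.
\<close>

lemma increment_bound_tendsto: "(\<lambda>k. increment_bound k u v) \<longlonglongrightarrow> 0"
proof -
  have b: "bounded (range (\<lambda>k. w (Suc k) + c))" if "bounded (range (\<lambda>k. w (Suc k)))"
    for w :: "nat \<Rightarrow> 'c::real_normed_vector" and c
    using that by (intro bounded_plus_comp) simp_all
  have Suc: "bounded (range (\<lambda>k. w (Suc k)))" if "bounded (range w)" for w :: "nat \<Rightarrow> 'c::real_normed_vector"
    using that by (rule bounded_subset) auto
  have "(\<lambda>k. ((xbar k - xbar (Suc k)) \<bullet> (xbar (Suc k) + (\<sigma> *\<^sub>R adjoint K v - u))) / \<sigma>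
     + (N (d k - d (Suc k)) \<bullet> (d (Suc k) + - u)) / \<sigma>
     + ((ybar k - ybar (Suc k)) \<bullet> (ybar (Suc k) + (- v - \<tau> *\<^sub>R K u))) / \<tau>) \<longlonglongrightarrow> 0 / \<sigma> + 0 / \<sigma> + 0 / \<tau>"
    using \<sigma> \<tau>
    by (intro tendsto_add tendsto_divide tendsto_const tendsto_inner_null_bounded
        xbar_diff_tendsto ybar_diff_tendsto N_d_diff_tendsto b Suc bounded_iterates) auto
  then show ?thesis by (simp add: increment_bound_def algebra_simps)
qed

text \<open>
  Along the iterates the separator differs from an affine function of the two convergent energies only by a
  null sequence.
\<close>

lemma separator_convergent:
  assumes "saddle_point K F G s t" "saddle_point K F G s' t'"
  shows "convergent (\<lambda>k. separator (s' - s) (t' - t) (x (Suc k), y (Suc k)))"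
proof -
  let ?p = "s' - s" and ?q = "t' - t"
  let ?P = "?p - \<sigma> *\<^sub>R adjoint K ?q" and ?Q = "?q + \<tau> *\<^sub>R K ?p"
  define c where "c = ((norm (s - \<sigma> *\<^sub>R adjoint K t))\<^sup>2 - (norm (s' - \<sigma> *\<^sub>R adjoint K t'))\<^sup>2
        + N s \<bullet> s - N s' \<bullet> s') / (2 * \<sigma>)
     + ((norm (t + \<tau> *\<^sub>R K s))\<^sup>2 - (norm (t' + \<tau> *\<^sub>R K s'))\<^sup>2) / (2 * \<tau>)"
  obtain l l' where l: "(\<lambda>k. energy k s t) \<longlonglongrightarrow> l" "(\<lambda>k. energy k s' t') \<longlonglongrightarrow> l'"
    using energy_convergent[OF assms(1)] energy_convergent[OF assms(2)] unfolding convergent_def by blast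
  let ?e = "\<lambda>k. ((xbar (Suc k) - (x (Suc k) - \<sigma> *\<^sub>R adjoint K (y (Suc k)))) \<bullet> ?P) / \<sigma>
     + (N (d (Suc k) - x (Suc k)) \<bullet> ?p) / \<sigma>
     + ((ybar (Suc k) - (y (Suc k) + \<tau> *\<^sub>R K (x (Suc k)))) \<bullet> ?Q) / \<tau>"
  have "?e \<longlonglongrightarrow> (0 \<bullet> ?P) / \<sigma> + (0 \<bullet> ?p) / \<sigma> + (0 \<bullet> ?Q) / \<tau>"
    using \<sigma> \<tau> by (intro tendsto_add tendsto_divide tendsto_inner tendsto_const
        xbar_asymptotic ybar_asymptotic N.tendsto_zero d_minus_x_tendsto) auto
  then have lim: "(\<lambda>k. energy (Suc k) s t - energy (Suc k) s' t' - c - ?e k) \<longlonglongrightarrow> l - l' - c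
      - ((0 \<bullet> ?P) / \<sigma> + (0 \<bullet> ?p) / \<sigma> + (0 \<bullet> ?Q) / \<tau>)"
    by (intro tendsto_diff tendsto_const LIMSEQ_Suc[OF l(1)] LIMSEQ_Suc[OF l(2)])
  have "separator ?p ?q (x (Suc k), y (Suc k)) = energy (Suc k) s t - energy (Suc k) s' t' - c - ?e k" for k
    unfolding energy_const_diff c_def separator_def fst_conv snd_conv
      inner_diff_left[of _ _ ?P] inner_diff_left[of _ _ ?Q] inner_diff_left[of _ _ ?p] N.diff
      add_divide_distrib[symmetric]
    by (simp add: inner_diff_left inner_add_left diff_divide_distrib add_divide_distrib)
  then have "(\<lambda>k. separator ?p ?q (x (Suc k), y (Suc k))) \<longlonglongrightarrow> l - l' - c
      - ((0 \<bullet> ?P) / \<sigma> + (0 \<bullet> ?p) / \<sigma> + (0 \<bullet> ?Q) / \<tau>)"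
    using lim by presburger
  then show ?thesis by (auto simp: convergent_def)
qed

lemma weak_cluster_saddle_point:
  assumes r: "strict_mono r" and z: "weakly_convergent_to (\<lambda>n. (x (Suc (r n)), y (Suc (r n)))) z"
  shows "saddle_point K F G (fst z) (snd z)"
proof (rule weak_limit_saddle_point)
  show "weakly_convergent_to (\<lambda>n. x (Suc (r n))) (fst z)"
    unfolding weakly_convergent_to_def
  proof (intro allI impI)
    fix h :: "'a \<Rightarrow> real" assume "bounded_linear h"
    from weakly_convergent_toD[OF z bounded_linear_compose[OF this bounded_linear_fst]]
    show "(\<lambda>n. h (x (Suc (r n)))) \<longlonglongrightarrow> h (fst z)" by simp
  qed
  show "weakly_convergent_to (\<lambda>n. y (Suc (r n))) (snd z)"
    unfolding weakly_convergent_to_def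
  proof (intro allI impI)
    fix h :: "'b \<Rightarrow> real" assume "bounded_linear h"
    from weakly_convergent_toD[OF z bounded_linear_compose[OF this bounded_linear_snd]]
    show "(\<lambda>n. h (y (Suc (r n)))) \<longlonglongrightarrow> h (snd z)" by simp
  qed
  fix u v assume uv: "u \<in> eff_dom F" "v \<in> eff_dom G"
  have "(\<lambda>n. increment_bound (r n) u v) \<longlonglongrightarrow> 0"
    using LIMSEQ_subseq_LIMSEQ[OF increment_bound_tendsto r] by (simp add: o_def)
  then show "\<exists>c. c \<longlonglongrightarrow> 0 \<and> (\<forall>n. gap (x (Suc (r n))) (y (Suc (r n))) u v \<le> c n)"
    using gap_le_increment_bound[OF uv] by (intro exI[of _ "\<lambda>n. increment_bound (r n) u v"]) simp
qed (rule x_eff_dom y_eff_dom)+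

text \<open>
  Opial's lemma in the product space, with the separators as functionals. The sequence is shifted
  because nothing is known about the pair with index \<open>0\<close>.
\<close>

lemma iterates_weakly_convergent:
  obtains s t where "saddle_point K F G s t" "weakly_convergent_to (\<lambda>k. (x k, y k)) (s, t)"
proof -
  let ?z = "\<lambda>k. (x (Suc k), y (Suc k))"
  let ?S = "{z. saddle_point K F G (fst z) (snd z)}"
  have bdd: "bounded (range ?z)"
  proof (rule bounded_subset)
    show "bounded (range (\<lambda>k. x (Suc k)) \<times> range (\<lambda>k. y (Suc k)))"
      by (intro bounded_Times bounded_iterates)
  qed auto
  have sep: "\<exists>h :: 'a \<times> 'b \<Rightarrow> real. bounded_linear h \<and> h z \<noteq> h z' \<and> convergent (\<lambda>n. h (?z n))"
    if "z \<in> ?S" "z' \<in> ?S" "z \<noteq> z'" for z z'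
  proof (intro exI conjI)
    let ?h = "separator (fst z - fst z') (snd z - snd z')"
    show "bounded_linear ?h" by (rule separator_bounded_linear)
    have "?h (z - z') \<noteq> 0"
      using separator_diag_nonzero[of "fst z - fst z'" "snd z - snd z'"] that(3)
      by (simp add: minus_prod_def prod_eq_iff)
    then show "?h z \<noteq> ?h z'"
      by (simp add: linear_diff[OF bounded_linear.linear[OF separator_bounded_linear]])
    show "convergent (\<lambda>n. ?h (?z n))" using that by (intro separator_convergent) auto
  qed
  have cluster: "l \<in> ?S" if "strict_mono r" "weakly_convergent_to (\<lambda>n. ?z (r n)) l" for r l
    using weak_cluster_saddle_point[OF that] by simp
  obtain l where l: "l \<in> ?S" "weakly_convergent_to ?z l"
    by (rule opial_separating_functionals[of ?z ?S, OF bdd])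
      (erule (1) cluster, erule (2) sep, erule (1) that)
  have "weakly_convergent_to (\<lambda>k. (x k, y k)) l"
    unfolding weakly_convergent_to_def
  proof (intro allI impI)
    fix h :: "'a \<times> 'b \<Rightarrow> real" assume "bounded_linear h"
    from weakly_convergent_toD[OF l(2) this] show "(\<lambda>k. h (x k, y k)) \<longlonglongrightarrow> h l"
      by (rule LIMSEQ_imp_Suc)
  qed
  with l(1) show thesis by (intro that[of "fst l" "snd l"]) auto
qed

end

end

section \<open>Convergence and gap estimate for the iteration\<close>

theorem theorem2:
  fixes K :: "'a::{real_inner, complete_space} \<Rightarrow> 'b::{real_inner, complete_space}"
    and F :: "'a \<Rightarrow> ereal" and G :: "'b \<Rightarrow> ereal"
    and X0 :: "'a set" and Y0 :: "'b set"
    and \<sigma> \<tau> :: real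
    and M T :: "'a \<Rightarrow> 'a"
    and x b d xbar :: "nat \<Rightarrow> 'a" and y ybar :: "nat \<Rightarrow> 'b"
  assumes "bounded_linear K"
    and "proper F" and "convex_fun F" and "lower_semicontinuous F"
    and "proper G" and "convex_fun G" and "lower_semicontinuous G"
    and "X0 \<subseteq> eff_dom F" and "bounded X0"
    and "Y0 \<subseteq> eff_dom G" and "bounded Y0"
    and "\<exists>x'\<in>X0. \<exists>y'\<in>Y0. saddle_point K F G x' y'"
    and "\<sigma> > 0" and "\<tau> > 0"
    and "T = (\<lambda>u. u + (\<sigma> * \<tau>) *\<^sub>R adjoint K (K u))"
    and "feasible_preconditioner M T"
    and "pDR_iteration K F G \<sigma> \<tau> M T x y b d xbar ybar"
  shows "(\<exists>xs ys. saddle_point K F G xs ys \<and>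
            weakly_convergent_to (\<lambda>k. (x k, y k)) (xs, ys) \<and>
            weakly_convergent_to (\<lambda>k. (ergodic x k, ergodic y k)) (xs, ys))
       \<and> (\<forall>k\<ge>1. restricted_gap K F G X0 Y0 (ergodic x k) (ergodic y k)
            \<le> ereal (1 / real k) *
              (SUP (x', y') \<in> X0 \<times> Y0. ereal (
                 (norm (xbar 0 - x' + \<sigma> *\<^sub>R adjoint K y'))\<^sup>2 / (2 * \<sigma>)
               + weighted_norm_sq (\<lambda>u. M u - T u) (d 0 - x') / (2 * \<sigma>)
               + (norm (ybar 0 - y' - \<tau> *\<^sub>R K x'))\<^sup>2 / (2 * \<tau>))))"
proof -
  interpret preconditioned_douglas_rachford K F G \<sigma> \<tau> M T x b d xbar y ybar
    by (intro preconditioned_douglas_rachford.intro saddle_problem.intro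
        preconditioned_douglas_rachford_axioms.intro assms)
  obtain x' y' where "saddle_point K F G x' y'" using assms(12) by blast
  then obtain xs ys where s: "saddle_point K F G xs ys"
    and w: "weakly_convergent_to (\<lambda>k. (x k, y k)) (xs, ys)"
    by (rule iterates_weakly_convergent)
  have "weakly_convergent_to (\<lambda>k. (ergodic x k, ergodic y k)) (xs, ys)"
    using weakly_convergent_ergodic[OF w] by (simp add: ergodic_Pair[abs_def])
  moreover have "restricted_gap K F G X0 Y0 (ergodic x k) (ergodic y k)
            \<le> ereal (1 / real k) *
              (SUP (x', y') \<in> X0 \<times> Y0. ereal (
                 (norm (xbar 0 - x' + \<sigma> *\<^sub>R adjoint K y'))\<^sup>2 / (2 * \<sigma>)
               + weighted_norm_sq (\<lambda>u. M u - T u) (d 0 - x') / (2 * \<sigma>)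
               + (norm (ybar 0 - y' - \<tau> *\<^sub>R K x'))\<^sup>2 / (2 * \<tau>)))" if "k \<ge> 1" for k
    using restricted_gap_ergodic_le[OF assms(8,10) that]
    unfolding energy_def weighted_norm_sq_def N_def .
  ultimately show ?thesis using s w by blast
qed

end
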